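(* Let $s\in(0,n/2)$ be not an integer, let $[s]$ be its integer part and let $b=1-2(s-[s])\in(-1,1)$. If $U\in \mathcal D^{1+[s];b}_{\mathbf e}(\mathbb R^{n+1})$, then $$\iint_{\mathbb R^{n+1}}|y|^{b}|\nabla_b^{1+[s]}U|^2\,dz\ \ge\ 2^{2(1+[s])}\,\frac{\Gamma\big(\frac{n-2s}{4}+1+[s]\big)^2}{\Gamma\big(\frac{n-2s}{4}\big)^2}\iint_{\mathbb R^{n+1}} |y|^{b}|z|^{-2(1+[s])}|U|^2\,dz .$$
   Context: Points of $\mathbb R^{n+1}=\mathbb R^n\times\mathbb R$ are written $z=(x,y)$, and $dz=dx\,dy$. For $b\in(-1,1)$ put $\Delta_b=\Delta+b\,y^{-1}\partial_y$, where $\Delta$ is the Laplacian on $\mathbb R^{n+1}$. For an integer $j\ge0$ put $\nabla_b^{j}=\Delta_b^{j/2}$ (a scalar operator) if $j$ is even, and $\nabla_b^{j}=\nabla\Delta_b^{(j-1)/2}$ (a vector in $\mathbb R^{n+1}$) if $j$ is odd; the $0$-th power of an operator is the identity. $C^\infty_{c;\mathbf e}(\mathbb R^{n+1})$ is the space of functions in $C^\infty_c(\mathbb R^{n+1})$ that are even in $y$. If $U\in C^\infty_{c;\mathbf e}(\mathbb R^{n+1})$ then $\nabla_b^jU$ is continuous with compact support on $\mathbb R^{n+1}$ for every $j$. For an integer $k\ge0$ and $n+1+b>2k$, the Hilbert space $\mathcal D^{k;b}_{\mathbf e}(\mathbb R^{n+1})$ is the completion of $C^\infty_{c;\mathbf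 e}(\mathbb R^{n+1})$ in $L^2(\mathbb R^{n+1};|y|^b|z|^{-2k}dz)$ with respect to the norm whose square is $$\sum_{j=0}^{k}\iint_{\mathbb R^{n+1}}|y|^b|z|^{-2(k-j)}|\nabla_b^jU|^2\,dz .$$ For $U$ in this space, $\nabla_b^jU$ ($j\le k$) is defined by density. Here $k=1+[s]$ and $b=1-2(s-[s])$, so that $n+1+b>2k$ is equivalent to $n>2s$. *)

theory Defs
  imports "HOL-Analysis.Analysis"
begin

type_synonym 'n pt = "(real ^ 'n) \<times> real"

subsection \<open>Smooth functions\<close>

definition dir_deriv :: "'a::real_normed_vector \<Rightarrow> ('a \<Rightarrow> real) \<Rightarrow> 'a \<Rightarrow> real" where
  "dir_deriv v f = (\<lambda>z. frechet_derivative f (at z) v)"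

primrec Ck :: "nat \<Rightarrow> ('a::real_normed_vector \<Rightarrow> real) \<Rightarrow> bool" where
  "Ck 0 f \<longleftrightarrow> continuous_on UNIV f"
| "Ck (Suc m) f \<longleftrightarrow> (\<forall>z. f differentiable (at z)) \<and> (\<forall>v. Ck m (dir_deriv v f))"

definition Cinf_c_even :: "('n::finite pt \<Rightarrow> real) set" where
  "Cinf_c_even = {U. (\<forall>m. Ck m U) \<and> compact (closure {z. U z \<noteq> 0}) \<and>
                     (\<forall>x y. U (x, - y) = U (x, y))}"

subsection \<open>The operators on smooth functions\<close>

definition laplacian :: "('a::euclidean_space \<Rightarrow> real) \<Rightarrow> 'a \<Rightarrow> real" where
  "laplacian f = (\<lambda>z. \<Sum>i\<in>Basis. dir_deriv i (dir_deriv i f) z)"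

definition gradient :: "('a::euclidean_space \<Rightarrow> real) \<Rightarrow> 'a \<Rightarrow> 'a" where
  "gradient f = (\<lambda>z. \<Sum>i\<in>Basis. dir_deriv i f z *\<^sub>R i)"

definition deriv_y :: "('n::finite pt \<Rightarrow> real) \<Rightarrow> 'n pt \<Rightarrow> real" where
  "deriv_y U = dir_deriv (0, 1) U"

text \<open>For smooth \<open>U\<close> even in \<open>y\<close>, the function \<open>y\<^sup>-\<^sup>1 \<partial>\<^sub>y U\<close> extends smoothly across
  \<open>y = 0\<close>. The extension by continuity has to be part of the definition, because division by
  zero yields \<open>0\<close> in HOL, which is not the value of the extension.\<close>

definition deriv_y_over_y :: "('n::finite pt \<Rightarrow> real) \<Rightarrow> 'n pt \<Rightarrow> real" where
  "deriv_y_over_y U = (\<lambda>(x, y). if y \<noteq> 0 then deriv_y U (x, y) / y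
                                 else Lim (at 0) (\<lambda>t. deriv_y U (x, t) / t))"

definition Delta_b :: "real \<Rightarrow> ('n::finite pt \<Rightarrow> real) \<Rightarrow> 'n pt \<Rightarrow> real" where
  "Delta_b b U = (\<lambda>z. laplacian U z + b * deriv_y_over_y U z)"

text \<open>\<open>nabla_b b j U\<close> is scalar for even \<open>j\<close> and a vector for odd \<open>j\<close>. Both cases are placed
  in the direct sum of scalars and vectors, with the other component equal to zero; the
  embeddings are linear isometries, so \<open>norm (nabla_b b j U z)\<close> is the norm of
  the scalar or of the vector, respectively.\<close>

definition nabla_b :: "real \<Rightarrow> nat \<Rightarrow> ('n::finite pt \<Rightarrow> real) \<Rightarrow> 'n pt \<Rightarrow> real \<times> 'n pt" where
  "nabla_b b j U = (\<lambda>z. if even j then ((Delta_b b ^^ (j div 2)) U z, 0)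
                         else (0, gradient ((Delta_b b ^^ ((j - 1) div 2)) U) z))"

subsection \<open>Weighted square-integrable functions and the energy space\<close>

definition wt :: "real \<Rightarrow> nat \<Rightarrow> 'n::finite pt \<Rightarrow> real" where
  "wt b i = (\<lambda>z. \<bar>snd z\<bar> powr b / norm z ^ (2 * i))"

definition wL2_sq :: "real \<Rightarrow> nat \<Rightarrow> ('n::finite pt \<Rightarrow> 'c::real_normed_vector) \<Rightarrow> ennreal" where
  "wL2_sq b i F = (\<integral>\<^sup>+z. ennreal (wt b i z * (norm (F z))\<^sup>2) \<partial>lebesgue)"

definition wL2 :: "real \<Rightarrow> nat \<Rightarrow> ('n::finite pt \<Rightarrow> 'c::real_normed_vector) set" where
  "wL2 b i = {F. F \<in> borel_measurable lebesgue \<and> wL2_sq b i F < \<infinity>}"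

definition D_norm_sq :: "nat \<Rightarrow> real \<Rightarrow> ('n::finite pt \<Rightarrow> real) \<Rightarrow> ennreal" where
  "D_norm_sq k b V = (\<Sum>j\<le>k. wL2_sq b (k - j) (nabla_b b j V))"

text \<open>\<open>D_approx k b V U\<close>: the sequence \<open>V\<close> of test functions is a Cauchy sequence for the norm
  of the energy space and converges to \<open>U\<close> in the ambient weighted space, so that \<open>U\<close> is the
  element of the completion represented by \<open>V\<close>.\<close>

definition D_approx ::
  "nat \<Rightarrow> real \<Rightarrow> (nat \<Rightarrow> 'n::finite pt \<Rightarrow> real) \<Rightarrow> ('n pt \<Rightarrow> real) \<Rightarrow> bool" where
  "D_approx k b V U \<longleftrightarrow>
     (\<forall>m. V m \<in> Cinf_c_even) \<and>
     (\<forall>e>0. \<exists>M. \<forall>m\<ge>M. \<forall>p\<ge>M. D_norm_sq k b (\<lambda>z. V m z - V p z) < e) \<and>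
     (\<lambda>m. wL2_sq b k (\<lambda>z. V m z - U z)) \<longlonglongrightarrow> 0"

definition D_even :: "nat \<Rightarrow> real \<Rightarrow> ('n::finite pt \<Rightarrow> real) set" where
  "D_even k b = {U \<in> wL2 b k. \<exists>V. D_approx k b V U}"

text \<open>The extension of \<open>nabla_b b j\<close> to the energy space by density. As usual for
  square-integrable functions, the value is determined up to null sets; \<open>nabla_D\<close> selects
  a representative.\<close>

definition is_nabla_D ::
  "nat \<Rightarrow> real \<Rightarrow> nat \<Rightarrow> ('n::finite pt \<Rightarrow> real) \<Rightarrow> ('n pt \<Rightarrow> real \<times> 'n pt) \<Rightarrow> bool" where
  "is_nabla_D k b j U G \<longleftrightarrow>
     G \<in> wL2 b (k - j) \<and>
     (\<exists>V. D_approx k b V U \<and> (\<lambda>m. wL2_sq b (k - j) (\<lambda>z. nabla_b b j (V m) z - G z)) \<longlonglongrightarrow> 0)"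

definition nabla_D ::
  "nat \<Rightarrow> real \<Rightarrow> nat \<Rightarrow> ('n::finite pt \<Rightarrow> real) \<Rightarrow> 'n pt \<Rightarrow> real \<times> 'n pt" where
  "nabla_D k b j U = (SOME G. is_nabla_D k b j U G)"

end

theory Submission
  imports Defs
begin

text \<open>Let \<open>N = n + 1 + b\<close> and \<open>d\<mu> = |y|\<^sup>b dz\<close>. For test functions, tangential derivatives integrate to
  zero against \<open>\<mu>\<close>, and so does \<open>(1 + b) h + y \<partial>\<^sub>y h\<close>; with \<open>h\<close> involving \<open>y\<^sup>-\<^sup>1 \<partial>\<^sub>y w\<close> this gives Green's
  formula for \<open>\<Delta>\<^sub>b\<close>, and it also gives Euler's identity for the field \<open>z\<close>. These two identities are
  applied with the weights \<open>(|z|\<^sup>2 + e)\<^sup>-\<^sup>q\<close> in place of powers of \<open>|z|\<close>: all integrals are then finite,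
  and the errors caused by \<open>e > 0\<close> have a favourable sign. Completing two squares yields
  \<open>\<integral>(|z|\<^sup>2 + e)\<^sup>-\<^sup>q |\<Delta>\<^sub>b w|\<^sup>2 d\<mu> \<ge> ((N - 4 - 2q)(N + 2q) / 4)\<^sup>2 \<integral>(|z|\<^sup>2 + e)\<^sup>-\<^sup>q\<^sup>-\<^sup>2 w\<^sup>2 d\<mu>\<close>, without spherical
  harmonics. Iterating from Hardy's inequality (\<open>k\<close> odd) or from the trivial case (\<open>k\<close> even), letting
  \<open>e\<close> tend to \<open>0\<close>, and passing to the completion gives the theorem.\<close>

subsection \<open>Differentiation and averages in the last variable\<close>

text \<open>The constants come from powers of |z|. For the weight |z|^(-2q) and s = (N - 4 - 2q)/2,
  both completed squares vanish formally at w = |z|^(-s): the first is the square of z . grad w + s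
  w, the second that of |z|^2 Delta_b w + c w with c = s (N - 2 - s). Only the radial derivative
  enters the first one; the rest of the gradient is dropped by Cauchy-Schwarz, so no angular modes
  arise. The sign s >= 0, needed when Euler's identity is inserted, follows from N > 2k at every
  step of the iteration. One step removes the innermost \<open>Delta_b\<close>; its factor 4 a (a +
  k + 1) lengthens the rising product (a+1)...(a+k) at both ends, hence the quotient of Gamma
  values. Two obstacles shape the rest. The term \<open>deriv_y_over_y\<close>, a limit on y = 0,
  must be smooth and even again before \<open>Delta_b\<close> can be iterated; for even U it is the
  average of the second y-derivative over the segment from (x, 0) to (x, y). And
  \<open>nabla_D\<close> is a choice by \<open>SOME\<close>, which carries information only once a
  suitable function is known to exist; this requires completeness of a weighted L^2 space.\<close>

lemma dir_deriv_eq: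
  assumes "(f has_derivative f') (at z)"
  shows "dir_deriv v f z = f' v"
  unfolding dir_deriv_def using frechet_derivative_at[OF assms] by simp

lemma has_derivative_dir_deriv:
  assumes "f differentiable (at z)"
  shows "(f has_derivative (\<lambda>v. dir_deriv v f z)) (at z)"
  using assms unfolding dir_deriv_def by (simp add: frechet_derivative_works)

lemma bounded_linear_dir_deriv:
  assumes "f differentiable (at z)"
  shows "bounded_linear (\<lambda>v. dir_deriv v f z)"
  using has_derivative_dir_deriv[OF assms] has_derivative_bounded_linear by blast

lemma dir_deriv_local_zero:
  assumes "open S" "z \<in> S" "\<And>x. x \<in> S \<Longrightarrow> f x = 0"
  shows "dir_deriv v f z = 0"
proof -
  have "(f has_derivative (\<lambda>v. 0)) (at z)"
    by (rule has_derivative_transform_within_open[of "\<lambda>_. 0" _ _ _ S]) (use assms in auto)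
  then show ?thesis by (rule dir_deriv_eq)
qed

lemma Ck_Suc_D: "Ck (Suc m) f \<Longrightarrow> Ck m f"
proof (induction m arbitrary: f)
  case 0
  then show ?case
    by (auto intro!: continuous_at_imp_continuous_on differentiable_imp_continuous_within)
next
  case (Suc m)
  then show ?case by (metis Ck.simps(2))
qed

lemma Ck_le: "Ck m f \<Longrightarrow> l \<le> m \<Longrightarrow> Ck l f"
  by (induction m) (use Ck_Suc_D le_Suc_eq in blast)+

lemma Ck_continuous: "Ck m f \<Longrightarrow> continuous_on UNIV f"
  using Ck_le[of m f 0] by simp

lemma Ck_const: "Ck m (\<lambda>_. c)"
proof (induction m arbitrary: c)
  case (Suc m)
  have "dir_deriv v (\<lambda>_. c) = (\<lambda>_. 0)" for v :: 'a
    using dir_deriv_eq[OF has_derivative_const] by (auto simp: fun_eq_iff)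
  with Suc show ?case by auto
qed auto

lemma dir_deriv_add:
  assumes "f differentiable (at z)" "g differentiable (at z)"
  shows "dir_deriv v (\<lambda>x. f x + g x) z = dir_deriv v f z + dir_deriv v g z"
  using assms by (intro dir_deriv_eq has_derivative_add has_derivative_dir_deriv)

lemma dir_deriv_mult:
  assumes "f differentiable (at z)" "g differentiable (at z)"
  shows "dir_deriv v (\<lambda>x. f x * g x) z = f z * dir_deriv v g z + dir_deriv v f z * g z"
  using assms by (intro dir_deriv_eq has_derivative_mult has_derivative_dir_deriv)

lemma Ck_add: "Ck m f \<Longrightarrow> Ck m g \<Longrightarrow> Ck m (\<lambda>x. f x + g x)"
proof (induction m arbitrary: f g)
  case 0
  then show ?case by (auto intro: continuous_intros)
next
  case (Suc m)
  have "dir_deriv v (\<lambda>x. f x + g x) = (\<lambda>x. dir_deriv v f x + dir_deriv v g x)" for v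
    using Suc.prems by (auto simp: fun_eq_iff intro!: dir_deriv_add)
  with Suc show ?case by auto
qed

lemma Ck_mult: "Ck m f \<Longrightarrow> Ck m g \<Longrightarrow> Ck m (\<lambda>x. f x * g x)"
proof (induction m arbitrary: f g)
  case 0
  then show ?case by (auto intro: continuous_intros)
next
  case (Suc m)
  have "dir_deriv v (\<lambda>x. f x * g x) = (\<lambda>x. f x * dir_deriv v g x + dir_deriv v f x * g x)" for v
    using Suc.prems by (auto simp: fun_eq_iff intro!: dir_deriv_mult)
  moreover have "Ck m f" "Ck m g" using Suc.prems Ck_Suc_D by blast+
  ultimately show ?case using Suc by (auto intro!: Ck_add)
qed

lemma Ck_cmult: "Ck m f \<Longrightarrow> Ck m (\<lambda>x. c * f x)"
  by (rule Ck_mult[OF Ck_const])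

lemma Ck_sum: "(\<And>i. i \<in> A \<Longrightarrow> Ck m (f i)) \<Longrightarrow> Ck m (\<lambda>x. \<Sum>i\<in>A. f i x)"
  by (induction A rule: infinite_finite_induct) (auto intro: Ck_add simp: Ck_const)

definition Cinf :: "('a::real_normed_vector \<Rightarrow> real) \<Rightarrow> bool" where
  "Cinf f \<longleftrightarrow> (\<forall>m. Ck m f)"

lemma Cinf_Ck: "Cinf f \<Longrightarrow> Ck m f" by (simp add: Cinf_def)

lemma Cinf_differentiable: "Cinf f \<Longrightarrow> f differentiable (at z)"
  using Cinf_Ck[of f "Suc 0"] by simp

lemma Cinf_continuous: "Cinf f \<Longrightarrow> continuous_on S f"
  using Cinf_Ck[of f 0] continuous_on_subset by auto

lemma Cinf_dir_deriv: "Cinf f \<Longrightarrow> Cinf (dir_deriv v f)"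
  unfolding Cinf_def by (metis Ck.simps(2))

lemma Cinf_add: "Cinf f \<Longrightarrow> Cinf g \<Longrightarrow> Cinf (\<lambda>x. f x + g x)"
  and Cinf_cmult: "Cinf f \<Longrightarrow> Cinf (\<lambda>x. c * f x)"
  and Cinf_sum: "(\<And>i. i \<in> A \<Longrightarrow> Cinf (h i)) \<Longrightarrow> Cinf (\<lambda>x. \<Sum>i\<in>A. h i x)"
  by (auto simp: Cinf_def intro: Ck_add Ck_cmult Ck_sum)

section \<open>Averages over segments in the y direction, and their smoothness\<close>

lemma dir_deriv_pt:
  assumes "f differentiable (at z)"
  shows "dir_deriv (u, t) f z = dir_deriv (u, 0) f z + t * dir_deriv (0, 1) f z"
proof -
  interpret bounded_linear "\<lambda>v. dir_deriv v f z"
    by (rule bounded_linear_dir_deriv[OF assms])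
  have "(u, t) = (u, 0) + t *\<^sub>R (0, 1)" by simp
  then show ?thesis by (metis add scaleR real_scaleR_def)
qed

lemma dir_deriv_y_scale:
  assumes "f differentiable (at z)"
  shows "dir_deriv (0, t) f z = t * dir_deriv (0, 1) f z"
proof -
  interpret bounded_linear "\<lambda>v. dir_deriv v f z"
    by (rule bounded_linear_dir_deriv[OF assms])
  show ?thesis using scaleR[of t "(0, 1)"] by simp
qed

text \<open>Each y-derivative under the integral brings out one factor t, so the family over all j
  is closed under differentiation. The target is j = 0, which represents
  \<open>deriv_y_over_y\<close>.\<close>

definition avg_y :: "nat \<Rightarrow> ('n::finite pt \<Rightarrow> real) \<Rightarrow> 'n pt \<Rightarrow> real" where
  "avg_y j g z = integral (cbox 0 1) (\<lambda>t. t ^ j * g (fst z, t * snd z))"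

lemma continuous_on_avg_y_integrand:
  assumes "Cinf g"
  shows "continuous_on S (\<lambda>(z :: 'n::finite pt, t). t ^ j * g (fst z, t * snd z))"
proof -
  have "continuous_on S (\<lambda>p :: 'n pt \<times> real. g (fst (fst p), snd p * snd (fst p)))"
    by (rule continuous_on_compose2[OF Cinf_continuous[OF assms, of UNIV]])
       (auto intro!: continuous_intros)
  then show ?thesis
    by (auto simp: case_prod_unfold intro!: continuous_intros)
qed

lemma continuous_on_avg_y: "Cinf g \<Longrightarrow> continuous_on UNIV (avg_y j g)"
  unfolding avg_y_def
  by (rule integral_continuous_on_param) (rule continuous_on_avg_y_integrand)

lemma avg_y_integrand_integrable:
  fixes g :: "'n::finite pt \<Rightarrow> real"
  assumes "Cinf g"
  shows "(\<lambda>t. t ^ j * g (fst z, t * snd z)) integrable_on cbox 0 1"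
proof -
  have "continuous_on (cbox 0 1) (\<lambda>t. case (z, t) of (z, t) \<Rightarrow> t ^ j * g (fst z, t * snd z))"
    by (rule continuous_on_compose2[OF continuous_on_avg_y_integrand[OF assms, of UNIV j]])
       (auto intro!: continuous_intros)
  then show ?thesis unfolding prod.case by (rule integrable_continuous)
qed

lemma has_derivative_avg_y:
  fixes g :: "'n::finite pt \<Rightarrow> real"
  assumes g: "Cinf g"
  shows "(avg_y j g has_derivative
    (\<lambda>v. avg_y j (dir_deriv (fst v, 0) g) z + avg_y (Suc j) (dir_deriv (0, snd v) g) z)) (at z)"
proof -
  \<comment> \<open>\<open>leibniz_rule\<close> takes the derivative of the integrand as a
    continuous function with values in the bounded linear maps, hence \<open>Blinfun\<close>; its
    continuity is checked on single vectors through \<open>G_split\<close>.\<close>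
  define G where "G z t = Blinfun (\<lambda>v. t ^ j * dir_deriv (fst v, t * snd v) g (fst z, t * snd z))"
    for z :: "'n pt" and t
  have lin: "bounded_linear (\<lambda>v. dir_deriv (fst v, t * snd v) g w)" for t w
  proof -
    have "bounded_linear (\<lambda>v :: 'n pt. (fst v, t * snd v))"
      by (intro bounded_linear_intros)
    from bounded_linear_compose[OF bounded_linear_dir_deriv[OF Cinf_differentiable[OF g]] this]
    show ?thesis .
  qed
  have G_apply: "blinfun_apply (G z t) v = t ^ j * dir_deriv (fst v, t * snd v) g (fst z, t * snd z)"
    for z t v
    unfolding G_def
    by (subst bounded_linear_Blinfun_apply)
       (auto intro!: bounded_linear_const_mult lin)
  have dir_deriv_0: "dir_deriv (0, 0) g w = 0" for w
    using linear_simps(3)[OF bounded_linear_dir_deriv[OF Cinf_differentiable[OF g]]]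
    by (simp add: zero_prod_def)
  have G_split: "blinfun_apply (G z t) v = t ^ j * dir_deriv (fst v, 0) g (fst z, t * snd z)
      + t ^ Suc j * dir_deriv (0, snd v) g (fst z, t * snd z)" for z t v
    unfolding G_apply
    using dir_deriv_pt[OF Cinf_differentiable[OF g], of "fst v" "t * snd v"]
      dir_deriv_pt[OF Cinf_differentiable[OF g], of 0 "snd v"]
    by (simp add: algebra_simps dir_deriv_0)
  have cG: "continuous_on S (\<lambda>(z, t). G z t)" for S
  proof (rule continuous_on_blinfun_componentwise)
    fix i :: "'n pt"
    have "continuous_on S (\<lambda>p. (case p of (z, t) \<Rightarrow> t ^ j * dir_deriv (fst i, 0) g (fst z, t * snd z))
      + (case p of (z, t) \<Rightarrow> t ^ Suc j * dir_deriv (0, snd i) g (fst z, t * snd z)))"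
      by (intro continuous_on_add continuous_on_avg_y_integrand Cinf_dir_deriv g)
    then show "continuous_on S (\<lambda>x. blinfun_apply (case x of (z, t) \<Rightarrow> G z t) i)"
      by (simp add: case_prod_unfold G_split)
  qed
  have der: "((\<lambda>z. t ^ j * g (fst z, t * snd z)) has_derivative blinfun_apply (G z t)) (at z)" for z t
  proof -
    have 1: "((\<lambda>z :: 'n pt. (fst z, t * snd z)) has_derivative (\<lambda>v. (fst v, t * snd v))) (at z)"
      by (auto intro!: derivative_eq_intros)
    have "((\<lambda>z. g (fst z, t * snd z)) has_derivative
        (\<lambda>v. dir_deriv (fst v, t * snd v) g (fst z, t * snd z))) (at z)"
      by (rule has_derivative_compose[OF 1
            has_derivative_dir_deriv[OF Cinf_differentiable[OF g]]])
    then have "((\<lambda>z. t ^ j * g (fst z, t * snd z)) has_derivative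
        (\<lambda>v. t ^ j * dir_deriv (fst v, t * snd v) g (fst z, t * snd z))) (at z)"
      by (rule has_derivative_mult_right)
    then show ?thesis by (simp add: G_apply[abs_def])
  qed
  have "(avg_y j g has_derivative blinfun_apply (integral (cbox 0 1) (G z))) (at z)"
    unfolding avg_y_def
    using leibniz_rule[of UNIV 0 1 "\<lambda>z t. t ^ j * g (fst z, t * snd z)" G z]
      avg_y_integrand_integrable[OF g] der cG by auto
  moreover have "blinfun_apply (integral (cbox 0 1) (G z))
      = (\<lambda>v. avg_y j (dir_deriv (fst v, 0) g) z + avg_y (Suc j) (dir_deriv (0, snd v) g) z)"
  proof
    fix v
    have "continuous_on (cbox 0 1) (\<lambda>t. case (z, t) of (z, t) \<Rightarrow> G z t)"
      by (rule continuous_on_compose2[OF cG[of UNIV]]) (auto intro!: continuous_intros)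
    then have "G z integrable_on cbox 0 1"
      unfolding prod.case by (rule integrable_continuous)
    then have "blinfun_apply (integral (cbox 0 1) (G z)) v
        = integral (cbox 0 1) (\<lambda>t. blinfun_apply (G z t) v)"
      by (rule blinfun_apply_integral)
    also have "\<dots> = avg_y j (dir_deriv (fst v, 0) g) z + avg_y (Suc j) (dir_deriv (0, snd v) g) z"
      unfolding G_split avg_y_def
      by (intro Henstock_Kurzweil_Integration.integral_add avg_y_integrand_integrable Cinf_dir_deriv g)
    finally show "blinfun_apply (integral (cbox 0 1) (G z)) v
        = avg_y j (dir_deriv (fst v, 0) g) z + avg_y (Suc j) (dir_deriv (0, snd v) g) z" .
  qed
  ultimately show ?thesis by simp
qed

text \<open>The induction generalizes over g and j because the derivative is a sum of averages of
  other functions, one of them with j raised by 1.\<close>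

lemma Ck_avg_y: "Cinf g \<Longrightarrow> Ck m (avg_y j g)"
proof (induction m arbitrary: g j)
  case 0
  then show ?case by (simp add: continuous_on_avg_y)
next
  case (Suc m)
  have "dir_deriv v (avg_y j g)
      = (\<lambda>z. avg_y j (dir_deriv (fst v, 0) g) z + avg_y (Suc j) (dir_deriv (0, snd v) g) z)" for v
    using dir_deriv_eq[OF has_derivative_avg_y[OF Suc.prems]] by (simp add: fun_eq_iff)
  then show ?case
    using Suc has_derivative_avg_y[OF Suc.prems]
    by (auto simp: differentiable_def intro!: Ck_add Suc.IH Cinf_dir_deriv; blast)
qed

lemma Cinf_avg_y: "Cinf g \<Longrightarrow> Cinf (avg_y j g)"
  by (simp add: Cinf_def Ck_avg_y[unfolded Cinf_def])

subsection \<open>The operators on even test functions\<close>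

text \<open>Compact support in a pointwise form, without closures; it passes directly to sums,
  products and derivatives and also serves vector-valued functions. The link is
  \<open>compact_support_iff\<close>.\<close>

definition vanishes_far :: "('a::real_normed_vector \<Rightarrow> 'b::zero) \<Rightarrow> bool" where
  "vanishes_far f \<longleftrightarrow> (\<exists>R. \<forall>z. R < norm z \<longrightarrow> f z = 0)"

lemma vanishes_far_add:
  fixes f g :: "'a::real_normed_vector \<Rightarrow> 'b::monoid_add"
  assumes "vanishes_far f" "vanishes_far g"
  shows "vanishes_far (\<lambda>z. f z + g z)"
proof -
  from assms obtain R S where "\<forall>z. R < norm z \<longrightarrow> f z = 0" "\<forall>z. S < norm z \<longrightarrow> g z = 0"
    by (auto simp: vanishes_far_def)
  then have "\<forall>z. max R S < norm z \<longrightarrow> f z + g z = 0" by auto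
  then show ?thesis unfolding vanishes_far_def by blast
qed

lemma vanishes_far_mono:
  "vanishes_far f \<Longrightarrow> (\<And>z. f z = 0 \<Longrightarrow> g z = 0) \<Longrightarrow> vanishes_far g"
  unfolding vanishes_far_def by blast

lemma vanishes_far_sum:
  fixes f :: "'i \<Rightarrow> 'a::real_normed_vector \<Rightarrow> 'b::comm_monoid_add"
  assumes "\<And>i. i \<in> A \<Longrightarrow> vanishes_far (f i)"
  shows "vanishes_far (\<lambda>z. \<Sum>i\<in>A. f i z)"
  using assms
  by (induction A rule: infinite_finite_induct)
     (auto intro: vanishes_far_add simp: vanishes_far_def[of "\<lambda>_. 0"])

lemma open_norm_greater: "open {z :: 'a::real_normed_vector. R < norm z}"
  by (intro open_Collect_less continuous_intros)

lemma vanishes_far_dir_deriv: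
  assumes "vanishes_far f"
  shows "vanishes_far (dir_deriv v f)"
proof -
  obtain R where R: "\<And>z. R < norm z \<Longrightarrow> f z = 0"
    using assms by (auto simp: vanishes_far_def)
  have "\<forall>z. R < norm z \<longrightarrow> dir_deriv v f z = 0"
    using dir_deriv_local_zero[OF open_norm_greater[of R], of _ f v] R by auto
  then show ?thesis unfolding vanishes_far_def by blast
qed

lemma compact_support_iff:
  "compact (closure {z :: 'a::euclidean_space. f z \<noteq> 0}) \<longleftrightarrow> vanishes_far f"
proof -
  have "compact (closure {z. f z \<noteq> 0}) \<longleftrightarrow> bounded {z. f z \<noteq> 0}"
    using bounded_closure bounded_subset[OF _ closure_subset]
    by (auto simp: compact_eq_bounded_closed)
  also have "\<dots> \<longleftrightarrow> vanishes_far f"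
    unfolding bounded_iff vanishes_far_def by (metis (mono_tags) linorder_not_less mem_Collect_eq)
  finally show ?thesis .
qed

lemma Cinf_c_even_iff:
  "U \<in> Cinf_c_even \<longleftrightarrow> Cinf U \<and> vanishes_far U \<and> (\<forall>x y. U (x, - y) = U (x, y))"
  unfolding Cinf_c_even_def Cinf_def compact_support_iff by auto

section \<open>Parity, and the quotient of the y-derivative by y\<close>

text \<open>Chain rule for the reflection of y. The factor c treats both parities at once: c = 1 for
  U itself, c = -1 for its y-derivative, which is odd.\<close>

lemma dir_deriv_even:
  fixes U :: "'n::finite pt \<Rightarrow> real"
  assumes d: "\<And>z. U differentiable (at z)" and e: "\<And>x y. U (x, - y) = c * U (x, y)"
  shows "dir_deriv (u, t) U (x, - y) = c * dir_deriv (u, - t) U (x, y)"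
proof -
  have *: "(U has_derivative (\<lambda>v. c * dir_deriv (fst v, - snd v) U (x, y))) (at (x, - y))"
  proof -
    have 1: "((\<lambda>z :: 'n pt. (fst z, - snd z)) has_derivative (\<lambda>v. (fst v, - snd v))) (at (x, - y))"
      by (auto intro!: derivative_eq_intros)
    have "((\<lambda>z. U (fst z, - snd z)) has_derivative (\<lambda>v. dir_deriv (fst v, - snd v) U (x, y)))
        (at (x, - y))"
      using has_derivative_compose[OF 1 has_derivative_dir_deriv[OF d]] by simp
    then have "((\<lambda>z. c * U (fst z, - snd z)) has_derivative
        (\<lambda>v. c * dir_deriv (fst v, - snd v) U (x, y))) (at (x, - y))"
      by (rule has_derivative_mult_right)
    moreover have "(\<lambda>z. c * U (fst z, - snd z)) = U"
    proof
      fix z show "c * U (fst z, - snd z) = U z" using e[of "fst z" "- snd z"] by simp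
    qed
    ultimately show ?thesis by simp
  qed
  from dir_deriv_eq[OF *, of "(u, t)"] show ?thesis by simp
qed

text \<open>Fundamental theorem of calculus for t -> f (x, t y) on [0, 1].\<close>

lemma snd_times_avg_y:
  fixes f :: "'n::finite pt \<Rightarrow> real"
  assumes f: "Cinf f" and 0: "f (x, 0) = 0"
  shows "y * avg_y 0 (dir_deriv (0, 1) f) (x, y) = f (x, y)"
proof -
  have "((\<lambda>t. y * dir_deriv (0, 1) f (x, t * y)) has_integral f (x, 1 * y) - f (x, 0 * y)) {0..1}"
  proof (rule fundamental_theorem_of_calculus)
    fix t :: real assume "t \<in> {0..1}"
    have 1: "((\<lambda>t. (x, t * y)) has_derivative (\<lambda>h. (0, h * y))) (at t within {0..1})"
      by (auto intro!: derivative_eq_intros)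
    have "((\<lambda>t. f (x, t * y)) has_derivative (\<lambda>h. dir_deriv (0, h * y) f (x, t * y))) (at t within {0..1})"
      by (rule has_derivative_compose[OF 1 has_derivative_dir_deriv[OF Cinf_differentiable[OF f]]])
    moreover have "dir_deriv (0, h * y) f w = h * (y * dir_deriv (0, 1) f w)" for h w
      using dir_deriv_y_scale[OF Cinf_differentiable[OF f], of "h * y"] by simp
    ultimately show "((\<lambda>t. f (x, t * y)) has_vector_derivative y * dir_deriv (0, 1) f (x, t * y))
        (at t within {0..1})"
      by (simp add: has_vector_derivative_def)
  qed simp
  then have "integral {0..1} (\<lambda>t. y * dir_deriv (0, 1) f (x, t * y)) = f (x, 1 * y) - f (x, 0 * y)"
    by (rule integral_unique)
  then show ?thesis using 0 by (simp add: avg_y_def)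
qed

lemma sum_Basis_pt:
  fixes f :: "'n::finite pt \<Rightarrow> 'c::comm_monoid_add"
  shows "(\<Sum>i\<in>Basis. f i) = (\<Sum>i\<in>Basis. f (i, 0)) + f (0, 1)"
proof -
  have "(\<Sum>i\<in>Basis. f i) = (\<Sum>i\<in>(\<lambda>u. (u, 0)) ` Basis. f i) + (\<Sum>i\<in>Pair 0 ` Basis. f i)"
    unfolding Basis_prod_def by (intro sum.union_disjoint) auto
  then show ?thesis
    by (simp add: sum.reindex inj_on_def)
qed

context
  fixes U :: "'n::finite pt \<Rightarrow> real"
  assumes U: "U \<in> Cinf_c_even"
begin

private lemma smooth: "Cinf U" and far: "vanishes_far U" and even: "U (x, - y) = U (x, y)"
  using U by (auto simp: Cinf_c_even_iff)

lemma dir_deriv_y_axis: "dir_deriv (0, 1) U (x, 0) = 0"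
proof -
  have "dir_deriv (0, 1) U (x, 0) = - dir_deriv (0, 1) U (x, 0)"
    using dir_deriv_even[of U 1 0 1 x 0] dir_deriv_y_scale[OF Cinf_differentiable[OF smooth], of "-1"]
    by (simp add: even Cinf_differentiable[OF smooth])
  then show ?thesis by simp
qed

text \<open>The y-derivative of an even function vanishes on y = 0, so
  \<open>snd_times_avg_y\<close> applies to it and identifies the quotient for y != 0. Continuity of
  the average then computes the \<open>Lim\<close> in the definition. Smoothness of the quotient
  follows from that of averages.\<close>

lemma deriv_y_over_y_eq_avg_y:
  "deriv_y_over_y U = avg_y 0 (dir_deriv (0, 1) (dir_deriv (0, 1) U))"
proof
  fix z :: "'n pt"
  obtain x y where z: "z = (x, y)" by (cases z)
  let ?a = "avg_y 0 (dir_deriv (0, 1) (dir_deriv (0, 1) U))"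
  have q: "deriv_y U (x, t) / t = ?a (x, t)" if "t \<noteq> 0" for t
    using snd_times_avg_y[OF Cinf_dir_deriv[OF smooth], of "(0, 1)" x t] dir_deriv_y_axis that
    by (simp add: deriv_y_def field_simps)
  have "Lim (at 0) (\<lambda>t. deriv_y U (x, t) / t) = ?a (x, 0)"
  proof (rule tendsto_Lim)
    have "continuous_on UNIV (\<lambda>t. ?a (x, t))"
      by (rule continuous_on_compose2[OF Cinf_continuous, of _ UNIV])
         (auto intro!: continuous_intros Cinf_avg_y Cinf_dir_deriv smooth)
    then have "((\<lambda>t. ?a (x, t)) \<longlongrightarrow> ?a (x, 0)) (at 0)"
      by (simp add: continuous_on_def)
    then show "((\<lambda>t. deriv_y U (x, t) / t) \<longlongrightarrow> ?a (x, 0)) (at 0)"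
      by (rule Lim_transform_eventually) (auto simp: q eventually_at_filter)
  qed simp
  then show "deriv_y_over_y U z = ?a z"
    by (simp add: deriv_y_over_y_def z q)
qed

lemma snd_times_deriv_y_over_y: "snd z * deriv_y_over_y U z = dir_deriv (0, 1) U z"
  using snd_times_avg_y[OF Cinf_dir_deriv[OF smooth] dir_deriv_y_axis, of "snd z" "fst z"]
  unfolding deriv_y_over_y_eq_avg_y prod.collapse .

lemma Cinf_deriv_y_over_y: "Cinf (deriv_y_over_y U)"
  unfolding deriv_y_over_y_eq_avg_y by (intro Cinf_avg_y Cinf_dir_deriv smooth)

text \<open>The integral formula does not show this, since the segment from (x, 0) to (x, y) may
  cross the support. Off the axis one divides by y instead; on the axis the value is a limit of
  values at points (x, t), whose norm is at least that of (x, 0).\<close>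

lemma vanishes_far_deriv_y_over_y: "vanishes_far (deriv_y_over_y U)"
proof -
  obtain R where R: "\<And>z. R < norm z \<Longrightarrow> dir_deriv (0, 1) U z = 0"
    using vanishes_far_dir_deriv[OF far, of "(0, 1)"] unfolding vanishes_far_def by blast
  have "deriv_y_over_y U z = 0" if "\<bar>R\<bar> < norm z" for z
  proof (cases "snd z = 0")
    case False
    then show ?thesis using snd_times_deriv_y_over_y[of z] R[of z] that by auto
  next
    case True
    have "((\<lambda>t. deriv_y_over_y U (fst z, t)) \<longlongrightarrow> deriv_y_over_y U (fst z, 0)) (at 0)"
    proof -
      have "continuous_on UNIV (\<lambda>t. deriv_y_over_y U (fst z, t))"
        by (rule continuous_on_compose2[OF Cinf_continuous[OF Cinf_deriv_y_over_y], of UNIV])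
           (auto intro!: continuous_intros)
      then show ?thesis by (simp add: continuous_on_def)
    qed
    moreover have "deriv_y_over_y U (fst z, t) = 0" if "t \<noteq> 0" for t
    proof -
      have "norm (fst z) = norm z" using True by (cases z) simp
      moreover have "norm (fst z) \<le> norm (fst z, t)"
        using norm_fst_le by blast
      ultimately have "R < norm (fst z, t)" using \<open>\<bar>R\<bar> < norm z\<close> by linarith
      then show ?thesis using snd_times_deriv_y_over_y[of "(fst z, t)"] R that by auto
    qed
    ultimately have "((\<lambda>t. 0) \<longlongrightarrow> deriv_y_over_y U (fst z, 0)) (at (0 :: real))"
      by (elim Lim_transform_eventually) (auto simp: eventually_at_filter)
    then have "deriv_y_over_y U (fst z, 0) = 0"
      using LIM_const_eq by fastforce
    then show ?thesis using True by (metis prod.collapse)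
  qed
  then show ?thesis unfolding vanishes_far_def by blast
qed

lemma deriv_y_over_y_even: "deriv_y_over_y U (x, - y) = deriv_y_over_y U (x, y)"
proof (cases "y = 0")
  case False
  have "dir_deriv (0, 1) U (x, - y) = - dir_deriv (0, 1) U (x, y)"
    using dir_deriv_even[of U 1 0 1 x y] dir_deriv_y_scale[OF Cinf_differentiable[OF smooth], of "-1"]
    by (simp add: even Cinf_differentiable[OF smooth])
  then show ?thesis
    using snd_times_deriv_y_over_y[of "(x, y)"] snd_times_deriv_y_over_y[of "(x, - y)"] False
    by (metis minus_mult_left mult_cancel_left neg_equal_iff_equal snd_conv)
qed simp

lemma laplacian_even: "laplacian U (x, - y) = laplacian U (x, y)"
proof -
  have d: "Cinf (dir_deriv v U)" for v by (intro Cinf_dir_deriv smooth)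
  have "dir_deriv (i, 0) (dir_deriv (i, 0) U) (x, - y) = dir_deriv (i, 0) (dir_deriv (i, 0) U) (x, y)" for i
    using dir_deriv_even[of "dir_deriv (i, 0) U" 1 i 0 x y] dir_deriv_even[of U 1 i 0]
    by (simp add: even Cinf_differentiable[OF smooth] Cinf_differentiable[OF d])
  moreover have "dir_deriv (0, 1) (dir_deriv (0, 1) U) (x, - y) = dir_deriv (0, 1) (dir_deriv (0, 1) U) (x, y)"
  proof -
    have neg: "dir_deriv (0, - 1) f z = - dir_deriv (0, 1) f z" if "Cinf f" for f and z :: "'n pt"
      using dir_deriv_y_scale[OF Cinf_differentiable[OF that], of "-1"] by simp
    have "dir_deriv (0, 1) U (x, - y) = - dir_deriv (0, 1) U (x, y)" for x y
      using dir_deriv_even[of U 1 0 1 x y]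
      by (simp add: even Cinf_differentiable[OF smooth] neg[OF smooth])
    then show ?thesis
      using dir_deriv_even[of "dir_deriv (0, 1) U" "- 1" 0 1 x y]
      by (simp add: Cinf_differentiable[OF d] neg[OF d])
  qed
  ultimately show ?thesis unfolding laplacian_def sum_Basis_pt by simp
qed

text \<open>This closure property makes iteration possible: evenness has to survive, or the quotient
  by y in the next application could be singular.\<close>

lemma Delta_b_Cinf_c_even: "Delta_b b U \<in> Cinf_c_even"
proof -
  have "Cinf (laplacian U)" unfolding laplacian_def
    by (intro Cinf_sum Cinf_dir_deriv smooth)
  moreover have "vanishes_far (laplacian U)" unfolding laplacian_def
    by (intro vanishes_far_sum vanishes_far_dir_deriv far)
  moreover have "vanishes_far (\<lambda>z. b * deriv_y_over_y U z)"
    by (rule vanishes_far_mono[OF vanishes_far_deriv_y_over_y]) simp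
  ultimately show ?thesis
    unfolding Cinf_c_even_iff Delta_b_def
    by (auto intro!: Cinf_add Cinf_cmult Cinf_deriv_y_over_y vanishes_far_add
        simp: laplacian_even deriv_y_over_y_even)
qed

end

section \<open>Linearity, continuity and support of the iterated operators\<close>

lemma Delta_b_funpow_Cinf_c_even: "U \<in> Cinf_c_even \<Longrightarrow> (Delta_b b ^^ m) U \<in> Cinf_c_even"
  by (induction m) (auto intro: Delta_b_Cinf_c_even)

lemma Cinf_c_even_diff:
  assumes "U \<in> Cinf_c_even" "V \<in> Cinf_c_even"
  shows "(\<lambda>z. U z - V z) \<in> Cinf_c_even"
proof -
  have "Cinf (\<lambda>z. U z + (- 1) * V z)" using assms
    by (intro Cinf_add Cinf_cmult) (auto simp: Cinf_c_even_iff)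
  moreover have "vanishes_far (\<lambda>z. U z + (- 1) * V z)" using assms
    by (intro vanishes_far_add) (auto simp: Cinf_c_even_iff intro: vanishes_far_mono)
  ultimately show ?thesis using assms by (auto simp: Cinf_c_even_iff)
qed

lemma dir_deriv_diff:
  assumes "Cinf f" "Cinf g"
  shows "dir_deriv v (\<lambda>z. f z - g z) = (\<lambda>z. dir_deriv v f z - dir_deriv v g z)"
  by (rule ext, intro dir_deriv_eq has_derivative_diff has_derivative_dir_deriv
      Cinf_differentiable assms)

text \<open>Linearity is not immediate from the \<open>Lim\<close> in \<open>deriv_y_over_y\<close>;
  it is read off from the integral formula. It serves to control differences of
  \<open>nabla_b\<close> along Cauchy sequences.\<close>

lemma Delta_b_diff:
  fixes U V :: "'a::finite pt \<Rightarrow> real"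
  assumes "U \<in> Cinf_c_even" "V \<in> Cinf_c_even"
  shows "Delta_b b (\<lambda>z. U z - V z) = (\<lambda>z. Delta_b b U z - Delta_b b V z)"
proof -
  have s: "Cinf U" "Cinf V" using assms by (auto simp: Cinf_c_even_iff)
  have dd: "dir_deriv v (dir_deriv v (\<lambda>z. U z - V z))
      = (\<lambda>z. dir_deriv v (dir_deriv v U) z - dir_deriv v (dir_deriv v V) z)" for v
    by (simp add: dir_deriv_diff s Cinf_dir_deriv)
  have avg: "avg_y 0 (\<lambda>z. f z - g z) = (\<lambda>z. avg_y 0 f z - avg_y 0 g z)"
    if "Cinf f" "Cinf g" for f g :: "'a pt \<Rightarrow> real"
  proof
    fix z show "avg_y 0 (\<lambda>z. f z - g z) z = avg_y 0 f z - avg_y 0 g z"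
    unfolding avg_y_def right_diff_distrib
    by (intro Henstock_Kurzweil_Integration.integral_diff avg_y_integrand_integrable that)
  qed
  show ?thesis
    unfolding Delta_b_def laplacian_def
    by (simp add: fun_eq_iff dd avg deriv_y_over_y_eq_avg_y[OF assms(1)] deriv_y_over_y_eq_avg_y[OF assms(2)]
        deriv_y_over_y_eq_avg_y[OF Cinf_c_even_diff[OF assms]] Cinf_dir_deriv s sum_subtractf algebra_simps)
qed

lemma Delta_b_funpow_diff:
  assumes "U \<in> Cinf_c_even" "V \<in> Cinf_c_even"
  shows "(Delta_b b ^^ m) (\<lambda>z. U z - V z) = (\<lambda>z. (Delta_b b ^^ m) U z - (Delta_b b ^^ m) V z)"
  by (induction m) (simp_all add: Delta_b_diff Delta_b_funpow_Cinf_c_even assms)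

lemma gradient_diff:
  assumes "Cinf f" "Cinf g"
  shows "gradient (\<lambda>z. f z - g z) z = gradient f z - gradient g z"
  by (simp add: gradient_def dir_deriv_diff[OF assms] sum_subtractf algebra_simps)

lemma nabla_b_diff:
  assumes "U \<in> Cinf_c_even" "V \<in> Cinf_c_even"
  shows "nabla_b b j (\<lambda>z. U z - V z) z = nabla_b b j U z - nabla_b b j V z"
  using Delta_b_funpow_Cinf_c_even[OF assms(1)] Delta_b_funpow_Cinf_c_even[OF assms(2)]
  by (simp add: nabla_b_def Delta_b_funpow_diff[OF assms] gradient_diff Cinf_c_even_iff)

lemma continuous_on_gradient: "Cinf f \<Longrightarrow> continuous_on S (gradient f)"
  unfolding gradient_def
  by (intro continuous_intros Cinf_continuous Cinf_dir_deriv)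

lemma continuous_on_nabla_b:
  assumes "U \<in> Cinf_c_even"
  shows "continuous_on UNIV (nabla_b b j U)"
  unfolding nabla_b_def
  using Delta_b_funpow_Cinf_c_even[OF assms, where b = b]
  by (cases "even j")
     (auto intro!: continuous_intros Cinf_continuous continuous_on_gradient simp: Cinf_c_even_iff)

lemma vanishes_far_gradient:
  assumes "vanishes_far f"
  shows "vanishes_far (gradient f)"
  unfolding gradient_def
  by (intro vanishes_far_sum vanishes_far_mono[OF vanishes_far_dir_deriv[OF assms]]) auto

lemma vanishes_far_nabla_b:
  fixes U :: "'n::finite pt \<Rightarrow> real"
  assumes "U \<in> Cinf_c_even"
  shows "vanishes_far (nabla_b b j U)"
proof -
  have "vanishes_far ((Delta_b b ^^ m) U)" for m
    using Delta_b_funpow_Cinf_c_even[OF assms, where b = b and m = m] by (simp add: Cinf_c_even_iff)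
  then have "vanishes_far (\<lambda>z. ((Delta_b b ^^ m) U z, 0 :: 'n pt))"
    "vanishes_far (\<lambda>z. (0 :: real, gradient ((Delta_b b ^^ m) U) z))" for m
    using vanishes_far_mono[of "(Delta_b b ^^ m) U" "\<lambda>z. ((Delta_b b ^^ m) U z, 0 :: 'n pt)"]
      vanishes_far_mono[of "gradient ((Delta_b b ^^ m) U)" "\<lambda>z. (0 :: real, gradient ((Delta_b b ^^ m) U) z)"]
      vanishes_far_gradient[of "(Delta_b b ^^ m) U"]
    by (auto simp: zero_prod_def)
  then show ?thesis unfolding nabla_b_def by (cases "even j") simp_all
qed

subsection \<open>Integration by parts with the weight\<close>

definition mu :: "real \<Rightarrow> 'n::finite pt measure" where
  "mu b = density lborel (\<lambda>z. ennreal (\<bar>snd z\<bar> powr b))"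

lemma borel_measurable_snd_pt[measurable]: "(snd :: 'n::finite pt \<Rightarrow> real) \<in> borel_measurable borel"
  by (intro borel_measurable_continuous_onI continuous_intros)

lemma borel_measurable_abs_snd_powr[measurable]:
  "(\<lambda>z :: 'n::finite pt. \<bar>snd z\<bar> powr b) \<in> borel_measurable borel"
  by measurable

lemma Ck_1_D:
  assumes "Ck 1 h"
  shows "h differentiable (at z)" "continuous_on UNIV h" "continuous_on UNIV (dir_deriv v h)"
  using assms Ck_continuous[OF assms] unfolding One_nat_def Ck.simps by blast+

lemma sets_mu[measurable_cong]: "sets (mu b) = sets borel"
  and space_mu[simp]: "space (mu b) = UNIV"
  by (simp_all add: mu_def)

text \<open>Here b > -1 enters: it makes |t|^b integrable at 0.\<close>

lemma nn_integral_abs_powr_finite: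
  fixes b R :: real
  assumes b: "- 1 < b" and R: "0 \<le> R"
  shows "(\<integral>\<^sup>+t. ennreal (\<bar>t\<bar> powr b * indicator {-R..R} t) \<partial>lborel) < \<infinity>"
proof -
  obtain I where I: "((\<lambda>t. t powr b) has_integral I) {0..R}"
    using has_integral_powr_from_0[OF b R] by blast
  have 1: "((\<lambda>t. \<bar>t\<bar> powr b) has_integral I) {0..R}"
    using I by (rule has_integral_eq[rotated]) auto
  then have 2: "((\<lambda>t. \<bar>t\<bar> powr b) has_integral I) {-R..-0}"
    by (subst (asm) has_integral_reflect_real[symmetric]) simp
  have "((\<lambda>t. \<bar>t\<bar> powr b) has_integral (I + I)) {-R..R}"
    by (rule has_integral_combine[OF _ _ 2[simplified] 1]) (use R in auto)
  then have "integral\<^sup>N lborel (\<lambda>t. ennreal (indicator {-R..R} t * (\<bar>t\<bar> powr b))) = ennreal (I + I)"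
    by (intro nn_integral_has_integral_lebesgue) auto
  then show ?thesis by (simp add: mult.commute)
qed

lemma ennreal_prod_less_top:
  fixes f :: "'a \<Rightarrow> ennreal"
  shows "(\<And>i. i \<in> A \<Longrightarrow> f i < top) \<Longrightarrow> prod f A < top"
  by (induction A rule: infinite_finite_induct) (auto simp: ennreal_mult_less_top)

text \<open>The ball lies in a cube, and on the cube the weight is a product of functions of one
  coordinate: |t|^b in the last one and 1 in the others. The integral therefore factorizes.\<close>

lemma emeasure_mu_cball:
  assumes b: "- 1 < b"
  shows "emeasure (mu b :: 'n::finite pt measure) (cball 0 R) < \<infinity>"
proof (cases "0 \<le> R")
  case False
  then show ?thesis by simp
next
  case R: True
  define f where "f i t = (if i = (0, 1 :: real) then \<bar>t\<bar> powr b * indicator {-R..R} t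
    else indicator {-R..R} t)" for i :: "'n pt" and t :: real
  have [measurable]: "f i \<in> borel_measurable borel" for i
    unfolding f_def by (cases "i = (0, 1)") auto
  have "emeasure (mu b :: 'n pt measure) (cball 0 R)
      = (\<integral>\<^sup>+z. ennreal (\<bar>snd z\<bar> powr b) * indicator (cball 0 R) z \<partial>(lborel :: 'n pt measure))"
    unfolding mu_def by (subst emeasure_density) auto
  also have "\<dots> \<le> (\<integral>\<^sup>+z. (\<Prod>i\<in>Basis. ennreal (f i (z \<bullet> i))) \<partial>(lborel :: 'n pt measure))"
  proof (rule nn_integral_mono)
    fix z :: "'n pt"
    show "ennreal (\<bar>snd z\<bar> powr b) * indicator (cball 0 R) z \<le> (\<Prod>i\<in>Basis. ennreal (f i (z \<bullet> i)))"
    proof (cases "z \<in> cball 0 R")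
      case True
      have "\<bar>z \<bullet> i\<bar> \<le> R" if "i \<in> Basis" for i
        using Basis_le_norm[OF that, of z] True by simp
      then have "z \<bullet> i \<in> {-R..R}" if "i \<in> Basis" for i
        using that by (auto simp: abs_le_iff minus_le_iff simp del: inner_prod_def)
      then have f: "f i (z \<bullet> i) = (if i = (0, 1) then \<bar>snd z\<bar> powr b else 1)" if "i \<in> Basis" for i
        using that unfolding f_def
        by (cases "i = (0, 1)") (simp_all add: indicator_def del: inner_prod_def atLeastAtMost_iff, simp add: inner_prod_def)
      have "(0, 1) \<in> (Basis :: 'n pt set)" by (auto simp: in_Basis_prod_iff)
      then have "(\<Prod>i\<in>Basis. ennreal (f i (z \<bullet> i))) = ennreal (\<bar>snd z\<bar> powr b)"
        by (subst prod.remove[of _ "(0, 1)"]) (auto simp: f intro!: prod.neutral)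
      then show ?thesis by (simp add: indicator_def)
    qed simp
  qed
  also have "\<dots> = (\<Prod>i\<in>(Basis :: 'n pt set). \<integral>\<^sup>+t. ennreal (f i t) \<partial>lborel)"
    by (rule nn_integral_lborel_prod) auto
  also have "\<dots> < \<infinity>"
  proof -
    have "(\<integral>\<^sup>+t. ennreal (f i t) \<partial>lborel) < \<infinity>" for i
      using nn_integral_abs_powr_finite[OF b R] R
      by (cases "i = (0, 1)") (auto simp: f_def ennreal_indicator)
    then show ?thesis by (simp add: ennreal_prod_less_top)
  qed
  finally show ?thesis .
qed

lemma vanishes_far_bounded:
  fixes f :: "'a::euclidean_space \<Rightarrow> 'b::real_normed_vector"
  assumes "continuous_on UNIV f" "vanishes_far f"
  obtains C where "0 < C" "\<And>z. norm (f z) \<le> C"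
proof -
  obtain R where R: "\<And>z. R < norm z \<Longrightarrow> f z = 0"
    using assms(2) by (auto simp: vanishes_far_def)
  have "bounded (f ` cball 0 R)"
    by (intro compact_imp_bounded compact_continuous_image continuous_on_subset[OF assms(1)]) auto
  then obtain C where C: "0 < C" "\<And>z. z \<in> cball 0 R \<Longrightarrow> norm (f z) \<le> C"
    unfolding bounded_pos by auto
  have "norm (f z) \<le> C" for z
    using C R[of z] by (cases "R < norm z") auto
  then show ?thesis using C(1) that by blast
qed

lemma integrable_mu_bounded:
  fixes f :: "'n::finite pt \<Rightarrow> 'b::{banach, second_countable_topology}"
  assumes b: "- 1 < b" and f: "f \<in> borel_measurable borel"
    and C: "\<And>z. norm (f z) \<le> C" and far: "vanishes_far f"
  shows "integrable (mu b) f"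
proof -
  obtain R where R: "\<And>z. R < norm z \<Longrightarrow> f z = 0"
    using far by (auto simp: vanishes_far_def)
  show ?thesis
  proof (rule integrableI_bounded_set[where A = "cball 0 R" and B = C])
    show "f \<in> borel_measurable (mu b)" using f by measurable
    show "cball 0 R \<in> sets (mu b)" by (simp add: sets_mu)
  qed (use emeasure_mu_cball[OF b] C R in auto)
qed

lemma integrable_mu:
  fixes f :: "'n::finite pt \<Rightarrow> 'b::{banach, second_countable_topology}"
  assumes b: "- 1 < b" and f: "continuous_on UNIV f" "vanishes_far f"
  shows "integrable (mu b) f"
proof -
  obtain C where "\<And>z. norm (f z) \<le> C" using vanishes_far_bounded[OF f] by blast
  with integrable_mu_bounded[OF b borel_measurable_continuous_onI[OF f(1)] _ f(2)] show ?thesis by blast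
qed

lemma integral_mu:
  assumes "f \<in> borel_measurable borel"
  shows "integral\<^sup>L (mu b) f = (\<integral>z. \<bar>snd z\<bar> powr b * f z \<partial>lborel)" (is ?A)
    and "integrable (mu b) f \<longleftrightarrow> integrable lborel (\<lambda>z. \<bar>snd z\<bar> powr b * f z)" (is ?B)
proof -
  show ?A unfolding mu_def using assms by (subst integral_density) auto
  show ?B unfolding mu_def using assms by (subst integrable_density) auto
qed

lemma integral_mu_translation:
  fixes f :: "'n::finite pt \<Rightarrow> real"
  assumes [measurable]: "f \<in> borel_measurable borel"
  shows "(\<integral>z. f (z + (u, 0)) \<partial>mu b) = (\<integral>z. f z \<partial>mu b)"
proof -
  have "(\<integral>z. f z \<partial>mu b) = (\<integral>z. \<bar>snd z\<bar> powr b * f z \<partial>distr lborel borel ((+) (u, 0)))"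
    by (simp add: integral_mu(1) lborel_distr_plus)
  also have "\<dots> = (\<integral>z. \<bar>snd z\<bar> powr b * f (z + (u, 0)) \<partial>lborel)"
    by (subst integral_distr) (auto simp: add.commute)
  also have "\<dots> = (\<integral>z. f (z + (u, 0)) \<partial>mu b)"
    by (subst integral_mu(1)) auto
  finally show ?thesis by simp
qed

lemma has_real_derivative_along_line:
  assumes "f differentiable (at (z + t *\<^sub>R v))"
  shows "((\<lambda>t. f (z + t *\<^sub>R v)) has_real_derivative dir_deriv v f (z + t *\<^sub>R v)) (at t)"
proof -
  have 1: "((\<lambda>t. z + t *\<^sub>R v) has_derivative (\<lambda>h. h *\<^sub>R v)) (at t)"
    by (auto intro!: derivative_eq_intros)
  have "((\<lambda>t. f (z + t *\<^sub>R v)) has_derivative (\<lambda>h. dir_deriv (h *\<^sub>R v) f (z + t *\<^sub>R v))) (at t)"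
    by (rule has_derivative_compose[OF 1 has_derivative_dir_deriv[OF assms]])
  moreover have "dir_deriv (h *\<^sub>R v) f (z + t *\<^sub>R v) = dir_deriv v f (z + t *\<^sub>R v) * h" for h
    using linear_simps(5)[OF bounded_linear_dir_deriv[OF assms]] by simp
  ultimately show ?thesis by (simp add: has_field_derivative_def)
qed

text \<open>The weight depends on y alone, so \<open>mu\<close> is invariant under translations in x
  and the difference quotients of h integrate to zero; dominated convergence passes to the
  derivative.\<close>

lemma integral_dir_deriv_x:
  fixes h :: "'n::finite pt \<Rightarrow> real"
  assumes b: "- 1 < b" and h: "Ck 1 h" "vanishes_far h"
  shows "(\<integral>z. dir_deriv (u, 0) h z \<partial>mu b) = 0"
proof -
  let ?v = "(u, 0) :: 'n pt" and ?D = "dir_deriv (u, 0) h"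
  have diff: "h differentiable (at z)" for z by (rule Ck_1_D[OF h(1)])
  have ch: "continuous_on UNIV h" and cD: "continuous_on UNIV ?D"
    by (rule Ck_1_D[OF h(1)])+
  have [measurable]: "h \<in> borel_measurable borel" "?D \<in> borel_measurable borel"
    using ch cD borel_measurable_continuous_onI by blast+
  obtain R where R: "\<And>z. R < norm z \<Longrightarrow> h z = 0"
    using h(2) by (auto simp: vanishes_far_def)
  obtain C where C: "0 < C" "\<And>z. norm (?D z) \<le> C"
    using vanishes_far_bounded[OF cD vanishes_far_dir_deriv[OF h(2)]] by blast
  define s where "s m z = (h (z + inverse (real (Suc m)) *\<^sub>R ?v) - h z) * real (Suc m)" for m z
  \<comment> \<open>The dominating function: by the mean value theorem a quotient is a value of the
    derivative, hence at most C in absolute value, and increments of length at most the norm of the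
    direction enlarge the support to this ball.\<close>
  define w where "w z = C * indicator (cball 0 (R + norm ?v)) z" for z :: "'n pt"
  have [measurable]: "s m \<in> borel_measurable borel" for m
    unfolding s_def by measurable
  have w: "integrable (mu b) w"
  proof (rule integrable_mu_bounded[OF b])
    show "vanishes_far w" unfolding vanishes_far_def w_def
      by (intro exI[of _ "R + norm ?v"]) auto
    show "norm (w z) \<le> C" for z using C(1) by (auto simp: w_def indicator_def)
    show "w \<in> borel_measurable borel"
      unfolding w_def by (intro borel_measurable_times borel_measurable_const borel_measurable_indicator) simp
  qed
  have "(\<lambda>m. integral\<^sup>L (mu b) (s m)) \<longlonglongrightarrow> integral\<^sup>L (mu b) ?D"
  proof (rule integral_dominated_convergence[where w = w])
    show "AE z in mu b. (\<lambda>m. s m z) \<longlonglongrightarrow> ?D z"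
    proof (rule AE_I2)
      fix z :: "'n pt"
      have "((\<lambda>t. h (z + t *\<^sub>R ?v)) has_real_derivative ?D z) (at 0)"
        using has_real_derivative_along_line[of h z 0 ?v] diff
        by (simp add: zero_prod_def[symmetric])
      then have "((\<lambda>t. (h (z + t *\<^sub>R ?v) - h z) / t) \<longlongrightarrow> ?D z) (at 0)"
        by (simp add: DERIV_def zero_prod_def[symmetric])
      moreover have "filterlim (\<lambda>m. inverse (real (Suc m))) (at 0) sequentially"
        using LIMSEQ_inverse_real_of_nat by (simp add: filterlim_at)
      ultimately have "(\<lambda>m. (h (z + inverse (real (Suc m)) *\<^sub>R ?v) - h z) / inverse (real (Suc m))) \<longlonglongrightarrow> ?D z"
        by (rule filterlim_compose)
      then show "(\<lambda>m. s m z) \<longlonglongrightarrow> ?D z" by (simp add: s_def divide_inverse)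
    qed
    show "AE z in mu b. norm (s m z) \<le> w z" for m
    proof (rule AE_I2)
      fix z :: "'n pt"
      define t where "t = inverse (real (Suc m))"
      have t: "0 < t" "t \<le> 1" by (auto simp: t_def inverse_le_1_iff)
      obtain x where x: "h (z + t *\<^sub>R ?v) - h (z + 0 *\<^sub>R ?v) = (t - 0) * ?D (z + x *\<^sub>R ?v)"
        using MVT2[of 0 t "\<lambda>t. h (z + t *\<^sub>R ?v)" "\<lambda>t. ?D (z + t *\<^sub>R ?v)"] t
          has_real_derivative_along_line diff by blast
      have s: "s m z = ?D (z + x *\<^sub>R ?v)"
      proof -
        have "h (z + t *\<^sub>R ?v) - h z = t * ?D (z + x *\<^sub>R ?v)"
          using x unfolding scaleR_zero_left add_0_right diff_0_right .
        then have "s m z = t * ?D (z + x *\<^sub>R ?v) * real (Suc m)"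
          unfolding s_def t_def[symmetric] by (rule arg_cong)
        then show ?thesis by (simp add: t_def)
      qed
      show "norm (s m z) \<le> w z"
      proof (cases "z \<in> cball 0 (R + norm ?v)")
        case True
        then show ?thesis using C(2) by (simp add: s w_def)
      next
        case False
        then have z: "R + norm ?v < norm z" by simp
        have "norm (t *\<^sub>R ?v) \<le> norm ?v" using t mult_right_mono[of t 1 "norm ?v"] by simp
        then have "R < norm (z + t *\<^sub>R ?v)"
          using z norm_diff_ineq[of z "t *\<^sub>R ?v"] by linarith
        moreover have "R < norm z" using z norm_ge_zero[of ?v] by linarith
        ultimately have "s m z = 0" using R by (simp add: s_def t_def)
        then show ?thesis using C(1) by (simp add: w_def indicator_def)
      qed
    qed
  qed (use w in auto)
  moreover have "integral\<^sup>L (mu b) (s m) = 0" for m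
  proof -
    define r where "r = inverse (real (Suc m))"
    have "vanishes_far (\<lambda>z. h (z + (r *\<^sub>R u, 0)))"
      unfolding vanishes_far_def
    proof (intro exI allI impI)
      fix z :: "'n pt" assume "R + norm (r *\<^sub>R u, 0 :: real) < norm z"
      then have "R < norm (z + (r *\<^sub>R u, 0))"
        using norm_diff_ineq[of z "(r *\<^sub>R u, 0)"] by linarith
      then show "h (z + (r *\<^sub>R u, 0)) = 0" by (rule R)
    qed
    then have "integrable (mu b) (\<lambda>z. h (z + (r *\<^sub>R u, 0)))"
      by (intro integrable_mu b continuous_on_compose2[OF ch]) (auto intro!: continuous_intros)
    moreover have "integrable (mu b) h" by (intro integrable_mu b ch h)
    moreover have "s m = (\<lambda>z. (h (z + (r *\<^sub>R u, 0)) - h z) * real (Suc m))"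
      by (simp add: fun_eq_iff s_def r_def)
    ultimately show ?thesis
      using integral_mu_translation[of h b "r *\<^sub>R u"]
      by (simp add: Bochner_Integration.integral_diff)
  qed
  ultimately show ?thesis by (simp add: LIMSEQ_const_iff)
qed

text \<open>The extra factor y is what makes partial integration work across y = 0: for b > -1 this
  function is continuous there, although its derivative may be unbounded.\<close>

lemma has_real_derivative_abs_powr:
  fixes y :: real
  assumes "y \<noteq> 0"
  shows "((\<lambda>y. \<bar>y\<bar> powr b * y) has_real_derivative (1 + b) * \<bar>y\<bar> powr b) (at y)"
proof -
  have "(abs has_real_derivative sgn y) (at y)"
  proof -
    have "((\<lambda>t. sgn y * t) has_real_derivative sgn y) (at y)"
      by (auto intro!: derivative_eq_intros)
    then show ?thesis
      by (rule has_field_derivative_transform_within_open[where S = "{t. 0 < sgn y * t}"])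
         (use assms in \<open>auto intro!: open_Collect_less continuous_intros simp: sgn_if split: if_splits\<close>)
  qed
  then have "((\<lambda>y. \<bar>y\<bar> powr b) has_real_derivative b * \<bar>y\<bar> powr (b - 1) * sgn y) (at y)"
    using assms by (auto intro!: derivative_eq_intros simp: field_simps powr_diff)
  from DERIV_mult[OF this DERIV_ident]
  have "((\<lambda>y. \<bar>y\<bar> powr b * y) has_real_derivative b * \<bar>y\<bar> powr (b - 1) * sgn y * y + \<bar>y\<bar> powr b) (at y)"
    by (simp add: algebra_simps)
  moreover have "\<bar>y\<bar> powr (b - 1) * (sgn y * y) = \<bar>y\<bar> powr b"
    using assms by (simp add: powr_diff abs_sgn[symmetric] mult.commute)
  ultimately show ?thesis by (simp add: algebra_simps)
qed

lemma continuous_on_abs_powr: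
  assumes "- 1 < b"
  shows "continuous_on S (\<lambda>y :: real. \<bar>y\<bar> powr b * y)"
proof (rule continuous_at_imp_continuous_on, rule ballI)
  fix y :: real
  show "isCont (\<lambda>y. \<bar>y\<bar> powr b * y) y"
  proof (cases "y = 0")
    case False
    then show ?thesis using has_real_derivative_abs_powr DERIV_isCont by blast
  next
    case True
    have "continuous_on UNIV (\<lambda>y :: real. \<bar>y\<bar> powr (1 + b))"
      using assms by (intro continuous_on_powr') (auto intro!: continuous_intros)
    then have "((\<lambda>y :: real. \<bar>y\<bar> powr (1 + b)) \<longlongrightarrow> 0) (at 0)"
      unfolding continuous_on_def by (metis UNIV_I abs_zero powr_0)
    \<comment> \<open>At 0 the absolute value of the function is a positive power of |y|.\<close>
    moreover have "\<bar>y\<bar> powr (1 + b) = \<bar>\<bar>y\<bar> powr b * y\<bar>" for y :: real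
      by (cases "y = 0") (auto simp: powr_add abs_mult)
    ultimately have "((\<lambda>y :: real. \<bar>y\<bar> powr b * y) \<longlongrightarrow> 0) (at 0)"
      by (simp add: tendsto_rabs_zero_iff)
    then show ?thesis using True by (simp add: isCont_def)
  qed
qed

text \<open>Times |y|^b, the integrand is the y-derivative of |y|^b y h, so its integral over each
  line parallel to the y-axis is zero; Fubini's theorem does the rest. Without the factor y, the
  derivative of the weight would not be locally integrable for b < 0.\<close>

lemma integral_dir_deriv_y:
  fixes h :: "'n::finite pt \<Rightarrow> real"
  assumes b: "- 1 < b" and h: "Ck 1 h" "vanishes_far h"
  shows "(\<integral>z. (1 + b) * h z + snd z * dir_deriv (0, 1) h z \<partial>mu b) = 0"
proof -
  let ?D = "dir_deriv (0, 1) h"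
  define F where "F z = \<bar>snd z\<bar> powr b * ((1 + b) * h z + snd z * ?D z)" for z
  have diff: "h differentiable (at z)" for z by (rule Ck_1_D[OF h(1)])
  have ch: "continuous_on UNIV h" and cD: "continuous_on UNIV ?D"
    by (rule Ck_1_D[OF h(1)])+
  have [measurable]: "h \<in> borel_measurable borel" "?D \<in> borel_measurable borel"
    using ch cD borel_measurable_continuous_onI by blast+
  obtain R where R: "\<And>z. R < norm z \<Longrightarrow> h z = 0 \<and> ?D z = 0"
  proof -
    obtain R1 R2 where "\<And>z. R1 < norm z \<Longrightarrow> h z = 0" "\<And>z. R2 < norm z \<Longrightarrow> ?D z = 0"
      using h(2) vanishes_far_dir_deriv[OF h(2), of "(0, 1)"] unfolding vanishes_far_def by blast
    then show ?thesis using that[of "max R1 R2"] by auto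
  qed
  have far: "vanishes_far (\<lambda>z. (1 + b) * h z + snd z * ?D z)"
    unfolding vanishes_far_def by (intro exI[of _ R]) (use R in simp)
  have "integrable (mu b) (\<lambda>z. (1 + b) * h z + snd z * ?D z)"
    by (intro integrable_mu b far continuous_intros ch cD)
  then have "integrable lborel F"
    unfolding F_def by (subst (asm) integral_mu(2)) auto
  then have int: "integrable (lborel \<Otimes>\<^sub>M lborel) F" by (simp add: lborel_prod)
  \<comment> \<open>Integrability on the line, which Fubini's theorem gives for almost every x,
    identifies the Lebesgue integral with the gauge integral computed below.\<close>
  have inner: "(\<integral>y. F (x, y) \<partial>lborel) = 0" if "integrable lborel (\<lambda>y. F (x, y))" for x
  proof -
    define S where "S = \<bar>R\<bar> + 1"
    have big: "h (x, y) = 0" "?D (x, y) = 0" if "S \<le> \<bar>y\<bar>" for y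
    proof -
      have "\<bar>y\<bar> \<le> norm (x, y)" using norm_snd_le[of y x] by simp
      then have "R < norm (x, y)" using that by (simp add: S_def)
      then show "h (x, y) = 0" "?D (x, y) = 0" using R by blast+
    qed
    have line: "((\<lambda>y. h (x, y)) has_real_derivative ?D (x, y)) (at y)" for y
      using has_real_derivative_along_line[of h "(x, 0)" y "(0, 1)"] diff by simp
    have "((\<lambda>y. F (x, y)) has_integral (\<bar>S\<bar> powr b * S) * h (x, S) - (\<bar>- S\<bar> powr b * (- S)) * h (x, - S)) {-S..S}"
    \<comment> \<open>The exceptional point 0 is where the primitive is only known to be
      continuous.\<close>
    proof (rule fundamental_theorem_of_calculus_interior_strong[where S = "{0}"])
      show "- S \<le> S" by (simp add: S_def)
      show "continuous_on {- S..S} (\<lambda>y. (\<bar>y\<bar> powr b * y) * h (x, y))"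
        by (intro continuous_on_mult continuous_on_abs_powr b continuous_on_compose2[OF ch])
           (auto intro!: continuous_intros)
      fix y assume "y \<in> {- S<..<S} - {0}"
      then have "((\<lambda>y. (\<bar>y\<bar> powr b * y) * h (x, y)) has_real_derivative
          ((1 + b) * \<bar>y\<bar> powr b) * h (x, y) + ?D (x, y) * (\<bar>y\<bar> powr b * y)) (at y)"
        by (intro DERIV_mult has_real_derivative_abs_powr line) auto
      then show "((\<lambda>y. (\<bar>y\<bar> powr b * y) * h (x, y)) has_vector_derivative F (x, y)) (at y)"
        by (simp add: has_real_derivative_iff_has_vector_derivative F_def algebra_simps)
    qed simp
    then have "((\<lambda>y. F (x, y)) has_integral 0) {-S..S}"
      using big by (simp add: S_def)
    then have "((\<lambda>y. F (x, y)) has_integral 0) UNIV"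
    proof (rule has_integral_on_superset)
      fix y assume "y \<notin> {-S..S}"
      then have "S \<le> \<bar>y\<bar>" by auto
      then show "F (x, y) = 0" using big by (simp add: F_def)
    qed simp
    with has_integral_integral_lborel[OF that] show ?thesis
      using has_integral_unique by blast
  qed
  have "AE x in lborel. (\<integral>y. F (x, y) \<partial>lborel) = 0"
    using lborel_pair.AE_integrable_fst'[OF int] by eventually_elim (rule inner)
  then have "(\<integral>x. \<integral>y. F (x, y) \<partial>lborel \<partial>lborel) = 0"
    by (rule integral_eq_zero_AE)
  then have "integral\<^sup>L lborel F = 0"
    using lborel_pair.integral_fst'[OF int] by (simp add: lborel_prod)
  then show ?thesis
    unfolding F_def by (subst integral_mu(1)) measurable
qed

section \<open>Euler's identity and Green's formula for the weighted measure\<close>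

lemma inner_gradient: "v \<bullet> gradient f z = (\<Sum>i\<in>Basis. (v \<bullet> i) * dir_deriv i f z)"
  by (simp add: gradient_def inner_sum_right mult.commute)

lemma norm_gradient: "(norm (gradient f z))\<^sup>2 = (\<Sum>i\<in>Basis. (dir_deriv i f z)\<^sup>2)"
proof -
  have "gradient f z \<bullet> i = dir_deriv i f z" if "i \<in> Basis" for i
    using that unfolding gradient_def by (rule inner_sum_left_Basis)
  then show ?thesis
    unfolding power2_norm_eq_inner inner_gradient by (simp add: power2_eq_square)
qed

lemma inner_gradient_le: "(z \<bullet> gradient f z)\<^sup>2 \<le> (norm z)\<^sup>2 * (norm (gradient f z))\<^sup>2"
  using Cauchy_Schwarz_ineq[of z "gradient f z"] by (simp add: power2_norm_eq_inner)

text \<open>The weighted divergence of f z, coordinate by coordinate: each tangential coordinate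
  contributes 1 to the coefficient of f and the last one 1 + b, in total the effective dimension
  N.\<close>

lemma integral_euler:
  fixes f :: "'n::finite pt \<Rightarrow> real"
  assumes b: "- 1 < b" and f: "Ck 1 f" "vanishes_far f"
  shows "(\<integral>z. (real CARD('n) + 1 + b) * f z + z \<bullet> gradient f z \<partial>mu b) = 0"
proof -
  let ?D = "\<lambda>i z. dir_deriv i f z"
  note diff = Ck_1_D(1)[OF f(1)] and cf = Ck_1_D(2)[OF f(1)] and cD = Ck_1_D(3)[OF f(1)]
  have far_mult: "vanishes_far (\<lambda>z. c z * g z)" if "vanishes_far g" for c g :: "'n pt \<Rightarrow> real"
    using that by (rule vanishes_far_mono) simp
  have x: "(\<integral>z. f z + (z \<bullet> (i, 0)) * ?D (i, 0) z \<partial>mu b) = 0"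
    and xi: "integrable (mu b) (\<lambda>z. f z + (z \<bullet> (i, 0)) * ?D (i, 0) z)"
    if i: "i \<in> Basis" for i :: "real ^ 'n"
  proof -
    have d: "((\<lambda>z. z \<bullet> (i, 0 :: real)) has_derivative (\<lambda>v. v \<bullet> (i, 0))) (at z)" for z
      by (intro derivative_intros)
    have ii: "(i, 0) \<bullet> (i, 0 :: real) = 1" using i by (simp add: inner_Basis)
    have D: "dir_deriv v (\<lambda>z. (z \<bullet> (i, 0)) * f z) = (\<lambda>z. (z \<bullet> (i, 0)) * ?D v z + (v \<bullet> (i, 0)) * f z)" for v
      by (rule ext, rule dir_deriv_eq, rule has_derivative_mult[OF d has_derivative_dir_deriv[OF diff]])
    have "(\<lambda>z. (z \<bullet> (i, 0)) * f z) differentiable (at z)" for z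
      by (rule differentiableI[OF has_derivative_mult[OF d has_derivative_dir_deriv[OF diff]]])
    then have "Ck 1 (\<lambda>z. (z \<bullet> (i, 0)) * f z)"
      unfolding One_nat_def Ck.simps D by (auto intro!: continuous_intros cf cD)
    from integral_dir_deriv_x[OF b this far_mult[OF f(2)], of i]
    show "(\<integral>z. f z + (z \<bullet> (i, 0)) * ?D (i, 0) z \<partial>mu b) = 0"
      unfolding D ii by (simp add: algebra_simps)
    show "integrable (mu b) (\<lambda>z. f z + (z \<bullet> (i, 0)) * ?D (i, 0) z)"
      by (intro integrable_mu b continuous_intros cf cD vanishes_far_add far_mult f(2) vanishes_far_dir_deriv)
  qed
  have y: "(\<integral>z. (1 + b) * f z + snd z * ?D (0, 1) z \<partial>mu b) = 0"
    by (rule integral_dir_deriv_y[OF b f])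
  have yi: "integrable (mu b) (\<lambda>z. (1 + b) * f z + snd z * ?D (0, 1) z)"
    by (intro integrable_mu b continuous_intros cf cD vanishes_far_add far_mult f(2) vanishes_far_dir_deriv)
  have "(real CARD('n) + 1 + b) * f z + z \<bullet> gradient f z
      = (\<Sum>i\<in>(Basis :: (real ^ 'n) set). f z + (z \<bullet> (i, 0)) * ?D (i, 0) z)
        + ((1 + b) * f z + snd z * ?D (0, 1) z)" for z
  proof -
    have "z \<bullet> (0, 1) = snd z" by (cases z) simp
    then show ?thesis
      unfolding inner_gradient sum_Basis_pt sum.distrib by (simp add: algebra_simps)
  qed
  then have "(\<integral>z. (real CARD('n) + 1 + b) * f z + z \<bullet> gradient f z \<partial>mu b)
      = (\<Sum>i\<in>(Basis :: (real ^ 'n) set). \<integral>z. f z + (z \<bullet> (i, 0)) * ?D (i, 0) z \<partial>mu b)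
        + (\<integral>z. (1 + b) * f z + snd z * ?D (0, 1) z \<partial>mu b)"
    using xi yi by (simp add: Bochner_Integration.integral_add Bochner_Integration.integral_sum
        del: Bochner_Integration.integral_mult_right_zero)
  also have "\<dots> = 0" using x y by simp
  finally show ?thesis .
qed

text \<open>Compact support of w alone suffices, because every product below contains w or a derived
  function. In the y direction, \<open>integral_dir_deriv_y\<close> is applied to f times
  \<open>deriv_y_over_y\<close> of w; the term with b in \<open>Delta_b\<close> then comes out
  without a boundary term on y = 0.\<close>

lemma integral_green:
  fixes w f :: "'n::finite pt \<Rightarrow> real"
  assumes b: "- 1 < b" and w: "w \<in> Cinf_c_even" and f: "Ck 1 f"
  shows "(\<integral>z. f z * Delta_b b w z + gradient f z \<bullet> gradient w z \<partial>mu b) = 0"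
proof -
  let ?D = "\<lambda>i z. dir_deriv i f z" and ?q = "deriv_y_over_y w"
  note diff = Ck_1_D(1)[OF f] and cf = Ck_1_D(2)[OF f] and cD = Ck_1_D(3)[OF f]
  have sw: "Cinf w" "vanishes_far w" using w by (auto simp: Cinf_c_even_iff)
  have sq: "Cinf ?q" "vanishes_far ?q"
    using Cinf_deriv_y_over_y[OF w] vanishes_far_deriv_y_over_y[OF w] by auto
  have far_mult: "vanishes_far (\<lambda>z. c z * g z)" if "vanishes_far g" for c g :: "'n pt \<Rightarrow> real"
    using that by (rule vanishes_far_mono) simp
  have D: "dir_deriv v (\<lambda>z. f z * dir_deriv v w z)
      = (\<lambda>z. f z * dir_deriv v (dir_deriv v w) z + ?D v z * dir_deriv v w z)" for v
    by (intro ext dir_deriv_mult diff Cinf_differentiable Cinf_dir_deriv sw)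
  define X where "X i = (\<lambda>z. f z * dir_deriv i (dir_deriv i w) z + ?D i z * dir_deriv i w z)" for i
  have Ck_fD: "Ck 1 (\<lambda>z. f z * dir_deriv v w z)" for v
    by (intro Ck_mult f Cinf_Ck Cinf_dir_deriv sw)
  have x: "integral\<^sup>L (mu b) (X (i, 0)) = 0" for i :: "real ^ 'n"
    unfolding X_def D[symmetric]
    by (intro integral_dir_deriv_x b Ck_fD far_mult vanishes_far_dir_deriv sw)
  have xi: "integrable (mu b) (X i)" for i
    unfolding X_def
    by (intro integrable_mu b continuous_intros cf cD Cinf_continuous Cinf_dir_deriv
        vanishes_far_add far_mult vanishes_far_dir_deriv sw)
  have y: "(\<integral>z. b * (f z * ?q z) + X (0, 1) z \<partial>mu b) = 0"
  proof -
    have "(\<integral>z. (1 + b) * (f z * ?q z) + snd z * dir_deriv (0, 1) (\<lambda>z. f z * ?q z) z \<partial>mu b) = 0"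
      by (intro integral_dir_deriv_y b Ck_mult f Cinf_Ck sq far_mult)
    moreover have "(1 + b) * (f z * ?q z) + snd z * dir_deriv (0, 1) (\<lambda>z. f z * ?q z) z
        = b * (f z * ?q z) + X (0, 1) z" for z
    proof -
      have d: "(\<lambda>z. f z * ?q z) differentiable (at z)" for z
        using Ck_1_D(1)[OF Ck_mult[OF f Cinf_Ck[OF sq(1)]]] .
      have ds: "((snd :: 'n pt \<Rightarrow> real) has_derivative snd) (at z)" for z
        by (intro derivative_intros)
      \<comment> \<open>Writing the y-derivative of w as y q, the product rule gives
        \<open>X (0, 1)\<close> = y d/dy (f q) + f q; this turns the coefficient 1 + b into
        b.\<close>
      have "(\<lambda>z. f z * dir_deriv (0, 1) w z) = (\<lambda>z. snd z * (f z * ?q z))"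
        using snd_times_deriv_y_over_y[OF w] by (simp add: fun_eq_iff algebra_simps)
      then have "X (0, 1) z = dir_deriv (0, 1) (\<lambda>z. snd z * (f z * ?q z)) z"
        unfolding X_def D[symmetric] by simp
      also have "\<dots> = snd z * dir_deriv (0, 1) (\<lambda>z. f z * ?q z) z + 1 * (f z * ?q z)"
        using dir_deriv_eq[OF has_derivative_mult[OF ds has_derivative_dir_deriv[OF d]], of "(0, 1)"]
        unfolding snd_conv .
      finally show ?thesis by (simp add: algebra_simps)
    qed
    ultimately show ?thesis by simp
  qed
  have yi: "integrable (mu b) (\<lambda>z. b * (f z * ?q z) + X (0, 1) z)"
    by (intro Bochner_Integration.integrable_add xi integrable_mu b continuous_intros cf
        Cinf_continuous sq far_mult)
  have "f z * Delta_b b w z + gradient f z \<bullet> gradient w z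
      = (\<Sum>i\<in>(Basis :: (real ^ 'n) set). X (i, 0) z) + (b * (f z * ?q z) + X (0, 1) z)" for z
  proof -
    have "gradient f z \<bullet> i = ?D i z" if "i \<in> Basis" for i
      using that unfolding gradient_def by (rule inner_sum_left_Basis)
    then have "gradient f z \<bullet> gradient w z = (\<Sum>i\<in>Basis. ?D i z * dir_deriv i w z)"
      unfolding inner_gradient by simp
    then have "f z * Delta_b b w z + gradient f z \<bullet> gradient w z = (\<Sum>i\<in>Basis. X i z) + b * (f z * ?q z)"
      unfolding X_def Delta_b_def laplacian_def by (simp add: sum.distrib sum_distrib_left algebra_simps)
    then show ?thesis unfolding sum_Basis_pt by simp
  qed
  then have "(\<integral>z. f z * Delta_b b w z + gradient f z \<bullet> gradient w z \<partial>mu b)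
      = (\<Sum>i\<in>(Basis :: (real ^ 'n) set). integral\<^sup>L (mu b) (X (i, 0)))
        + (\<integral>z. b * (f z * ?q z) + X (0, 1) z \<partial>mu b)"
    using xi yi by (simp only: Bochner_Integration.integral_add Bochner_Integration.integral_sum
        Bochner_Integration.integrable_sum)
  also have "\<dots> = 0" using x y by simp
  finally show ?thesis .
qed

section \<open>Regularized powers of |z|\<close>

definition reg :: "real \<Rightarrow> nat \<Rightarrow> 'a::real_inner \<Rightarrow> real" where
  "reg e p z = inverse (z \<bullet> z + e) ^ p"

context
  fixes e :: real
  assumes e: "0 < e"
begin

lemma reg_denominator_pos: "0 < z \<bullet> z + e"
  using e inner_ge_zero[of z] by linarith

lemma reg_pos: "0 < reg e p z"
  using reg_denominator_pos[of z] by (simp add: reg_def)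

lemma reg_Suc: "reg e p z = (z \<bullet> z + e) * reg e (Suc p) z"
  using reg_denominator_pos[of z] by (simp add: reg_def)

text \<open>For fixed e > 0, the regularization turns an identity valid at e = 0 into an inequality
  at two points only: here, and in the bound of z . z by z . z + e in
  \<open>integral_reg_gradient_ge\<close>.\<close>

lemma inner_times_reg_Suc_le: "(z \<bullet> z) * reg e (Suc p) z \<le> reg e p z"
  using e reg_pos[of "Suc p" z] by (simp add: reg_Suc[of p] mult_right_mono)

lemma continuous_on_reg:
  fixes S :: "'a::real_inner set"
  shows "continuous_on S (reg e p)"
proof -
  have "z \<bullet> z + e \<noteq> 0" for z :: 'a using reg_denominator_pos[of z] by linarith
  then show ?thesis unfolding reg_def by (intro continuous_intros) blast
qed

lemma has_derivative_reg:
  "(reg e p has_derivative (\<lambda>v. - 2 * real p * (z \<bullet> v) * reg e (Suc p) z)) (at z)"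
proof -
  have ne: "z \<bullet> z + e \<noteq> 0" using reg_denominator_pos[of z] by simp
  have "((\<lambda>z. inverse (z \<bullet> z + e)) has_derivative (\<lambda>v. - 2 * (z \<bullet> v) * inverse (z \<bullet> z + e) ^ 2)) (at z)"
    using ne by (auto intro!: derivative_eq_intros simp: power2_eq_square inner_commute)
  from has_derivative_power[OF this, of p]
  have "(reg e p has_derivative (\<lambda>v. real p * (- 2 * (z \<bullet> v) * inverse (z \<bullet> z + e) ^ 2)
      * inverse (z \<bullet> z + e) ^ (p - 1))) (at z)"
    unfolding reg_def by simp
  \<comment> \<open>For p = 0 the truncated p - 1 does no harm, since both sides vanish.\<close>
  moreover have "real p * (- 2 * c * x ^ 2) * x ^ (p - 1) = - 2 * real p * c * x ^ Suc p" for c x :: real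
    by (cases p) (simp_all add: power2_eq_square algebra_simps)
  ultimately show ?thesis unfolding reg_def by (simp only:)
qed

lemma dir_deriv_reg: "dir_deriv v (reg e p) = (\<lambda>z. - 2 * real p * (z \<bullet> v) * reg e (Suc p) z)"
  using dir_deriv_eq[OF has_derivative_reg] by (rule ext)

lemma differentiable_reg: "reg e p differentiable (at z)"
  using has_derivative_reg by (rule differentiableI)

lemma Ck_1_reg: "Ck 1 (reg e p)"
  unfolding One_nat_def Ck.simps dir_deriv_reg
  by (auto intro!: continuous_intros continuous_on_reg differentiable_reg)

end

subsection \<open>Regularized Hardy and Rellich inequalities\<close>

context
  fixes b e :: real and w :: "'n::finite pt \<Rightarrow> real"
  assumes b: "- 1 < b" and e: "0 < e" and w: "w \<in> Cinf_c_even"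
begin

private lemma w_smooth: "Cinf w" and w_far: "vanishes_far w"
  using w by (auto simp: Cinf_c_even_iff)

private lemma smooth_Delta: "Cinf (Delta_b b w)" and far_Delta: "vanishes_far (Delta_b b w)"
  using Delta_b_Cinf_c_even[OF w, of b] by (auto simp: Cinf_c_even_iff)

private lemma integrable_weighted:
  assumes "continuous_on UNIV c" "continuous_on UNIV g" "vanishes_far g"
  shows "integrable (mu b) (\<lambda>z. c z * g z :: real)"
  using assms by (intro integrable_mu b continuous_on_mult) (auto intro: vanishes_far_mono)

private lemma integrable_terms:
  "integrable (mu b) (\<lambda>z. reg e p z * (w z)\<^sup>2)"
  "integrable (mu b) (\<lambda>z. reg e p z * (w z * (z \<bullet> gradient w z)))"
  "integrable (mu b) (\<lambda>z. reg e p z * (norm (gradient w z))\<^sup>2)"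
  "integrable (mu b) (\<lambda>z. reg e p z * (w z * Delta_b b w z))"
  "integrable (mu b) (\<lambda>z. reg e p z * (Delta_b b w z)\<^sup>2)"
  by (intro integrable_weighted continuous_on_reg e continuous_intros Cinf_continuous w_smooth
        smooth_Delta continuous_on_gradient;
      (rule vanishes_far_mono[OF w_far] vanishes_far_mono[OF vanishes_far_gradient[OF w_far]]
        vanishes_far_mono[OF far_Delta]; simp))+

text \<open>Euler's identity for f = \<open>reg e p\<close> times w^2. Differentiating the weight
  gives -2p (z . z) \<open>reg e (Suc p)\<close> w^2, which is at least -2p \<open>reg e p\<close>
  w^2; this shifts N to N - 2p.\<close>

lemma integral_reg_radial_le:
  "2 * (\<integral>z. reg e p z * (w z * (z \<bullet> gradient w z)) \<partial>mu b)
    \<le> - (real CARD('n) + 1 + b - 2 * real p) * (\<integral>z. reg e p z * (w z)\<^sup>2 \<partial>mu b)"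
proof -
  let ?N = "real CARD('n) + 1 + b"
  define f where "f z = reg e p z * (w z * w z)" for z
  have Ckf: "Ck 1 f" unfolding f_def
    by (rule Ck_mult[OF Ck_1_reg[OF e] Ck_mult[OF Cinf_Ck[OF w_smooth] Cinf_Ck[OF w_smooth]]])
  have farf: "vanishes_far f" unfolding f_def by (rule vanishes_far_mono[OF w_far]) simp
  have D: "dir_deriv v f z = - 2 * real p * (z \<bullet> v) * reg e (Suc p) z * (w z)\<^sup>2
      + 2 * reg e p z * w z * dir_deriv v w z" for v z
    unfolding f_def dir_deriv_mult[OF differentiable_reg[OF e]
        Ck_1_D(1)[OF Ck_mult[OF Cinf_Ck[OF w_smooth] Cinf_Ck[OF w_smooth]]]]
      dir_deriv_mult[OF Cinf_differentiable[OF w_smooth] Cinf_differentiable[OF w_smooth]]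
      dir_deriv_reg[OF e]
    by (simp add: power2_eq_square algebra_simps)
  have grad: "z \<bullet> gradient f z = - 2 * real p * (z \<bullet> z) * reg e (Suc p) z * (w z)\<^sup>2
      + 2 * (reg e p z * (w z * (z \<bullet> gradient w z)))" for z
  proof -
    have "z \<bullet> gradient f z = - 2 * real p * (\<Sum>i\<in>Basis. (z \<bullet> i) * (z \<bullet> i)) * reg e (Suc p) z * (w z)\<^sup>2
        + 2 * (reg e p z * (w z * (\<Sum>i\<in>Basis. (z \<bullet> i) * dir_deriv i w z)))"
      unfolding inner_gradient[of z f] D
      by (simp add: algebra_simps sum.distrib sum_subtractf sum_distrib_left sum_distrib_right sum_negf del: inner_prod_def)
    then show ?thesis unfolding inner_gradient euclidean_inner[of z z] .
  qed
  have "(\<integral>z. (?N - 2 * real p) * (reg e p z * (w z)\<^sup>2) + 2 * (reg e p z * (w z * (z \<bullet> gradient w z))) \<partial>mu b)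
      \<le> (\<integral>z. ?N * f z + z \<bullet> gradient f z \<partial>mu b)"
  proof (rule integral_mono)
    show "integrable (mu b) (\<lambda>z. (?N - 2 * real p) * (reg e p z * (w z)\<^sup>2) + 2 * (reg e p z * (w z * (z \<bullet> gradient w z))))"
      by (intro Bochner_Integration.integrable_add integrable_mult_right integrable_terms)
    have "continuous_on UNIV (gradient f)"
      unfolding gradient_def by (intro continuous_intros Ck_1_D[OF Ckf])
    then show "integrable (mu b) (\<lambda>z. ?N * f z + z \<bullet> gradient f z)"
      by (intro integrable_mu b continuous_intros Ck_1_D[OF Ckf] vanishes_far_add
          vanishes_far_mono[OF farf] vanishes_far_mono[OF vanishes_far_gradient[OF farf]]) auto
    fix z
    have "(2 * real p * (w z)\<^sup>2) * ((z \<bullet> z) * reg e (Suc p) z) \<le> (2 * real p * (w z)\<^sup>2) * reg e p z"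
      by (intro mult_left_mono inner_times_reg_Suc_le e) auto
    then show "(?N - 2 * real p) * (reg e p z * (w z)\<^sup>2) + 2 * (reg e p z * (w z * (z \<bullet> gradient w z)))
        \<le> ?N * f z + z \<bullet> gradient f z"
      unfolding grad by (simp add: f_def power2_eq_square algebra_simps)
  qed
  also have "\<dots> = 0" by (rule integral_euler[OF b Ckf farf])
  finally have "(?N - 2 * real p) * (\<integral>z. reg e p z * (w z)\<^sup>2 \<partial>mu b)
      + 2 * (\<integral>z. reg e p z * (w z * (z \<bullet> gradient w z)) \<partial>mu b) \<le> 0"
    using integrable_terms by simp
  then show ?thesis unfolding mult_minus_left by linarith
qed

text \<open>Expands the square of z . grad w + s w against \<open>reg e (Suc q)\<close> and bounds
  (z . grad w)^2 by Cauchy-Schwarz, where the angular part of the gradient is discarded. The number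
  s is left free for the optimization in the two inequalities below.\<close>

lemma integral_reg_gradient_ge:
  "- 2 * s * (\<integral>z. reg e (Suc q) z * (w z * (z \<bullet> gradient w z)) \<partial>mu b)
      - s\<^sup>2 * (\<integral>z. reg e (Suc q) z * (w z)\<^sup>2 \<partial>mu b)
    \<le> (\<integral>z. reg e q z * (norm (gradient w z))\<^sup>2 \<partial>mu b)"
proof -
  have "(\<integral>z. - 2 * s * (reg e (Suc q) z * (w z * (z \<bullet> gradient w z)))
      - s\<^sup>2 * (reg e (Suc q) z * (w z)\<^sup>2) \<partial>mu b) \<le> (\<integral>z. reg e q z * (norm (gradient w z))\<^sup>2 \<partial>mu b)"
  proof (rule integral_mono)
    show "integrable (mu b) (\<lambda>z. - 2 * s * (reg e (Suc q) z * (w z * (z \<bullet> gradient w z)))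
      - s\<^sup>2 * (reg e (Suc q) z * (w z)\<^sup>2))"
      by (intro Bochner_Integration.integrable_diff integrable_mult_right integrable_terms)
    fix z
    have "(z \<bullet> gradient w z)\<^sup>2 \<le> (z \<bullet> z) * (norm (gradient w z))\<^sup>2"
      using inner_gradient_le[of z w] by (simp only: power2_norm_eq_inner)
    also have "\<dots> \<le> (z \<bullet> z + e) * (norm (gradient w z))\<^sup>2"
      using e by (intro mult_right_mono) auto
    finally have "0 \<le> (z \<bullet> z + e) * (norm (gradient w z))\<^sup>2 - (z \<bullet> gradient w z)\<^sup>2
        + (z \<bullet> gradient w z + s * w z)\<^sup>2"
      by simp
    then have "0 \<le> reg e (Suc q) z * ((z \<bullet> z + e) * (norm (gradient w z))\<^sup>2 - (z \<bullet> gradient w z)\<^sup>2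
        + (z \<bullet> gradient w z + s * w z)\<^sup>2)"
      using reg_pos[OF e, of "Suc q" z] by simp
    then show "- 2 * s * (reg e (Suc q) z * (w z * (z \<bullet> gradient w z)))
        - s\<^sup>2 * (reg e (Suc q) z * (w z)\<^sup>2) \<le> reg e q z * (norm (gradient w z))\<^sup>2"
      unfolding reg_Suc[OF e, of q] by (simp add: power2_eq_square algebra_simps)
  qed (rule integrable_terms)
  then show ?thesis using integrable_terms by simp
qed

text \<open>Green's formula for f = \<open>reg e q\<close> times w; the middle term comes from the
  gradient of the weight.\<close>

lemma integral_reg_green:
  "(\<integral>z. reg e q z * (w z * Delta_b b w z) \<partial>mu b)
    - 2 * real q * (\<integral>z. reg e (Suc q) z * (w z * (z \<bullet> gradient w z)) \<partial>mu b)
    + (\<integral>z. reg e q z * (norm (gradient w z))\<^sup>2 \<partial>mu b) = 0"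
proof -
  define f where "f z = reg e q z * w z" for z
  have Ckf: "Ck 1 f" unfolding f_def by (rule Ck_mult[OF Ck_1_reg[OF e] Cinf_Ck[OF w_smooth]])
  have D: "dir_deriv v f z = - 2 * real q * (z \<bullet> v) * reg e (Suc q) z * w z
      + reg e q z * dir_deriv v w z" for v z
    unfolding f_def dir_deriv_mult[OF differentiable_reg[OF e] Cinf_differentiable[OF w_smooth]]
      dir_deriv_reg[OF e]
    by simp
  have "gradient f z \<bullet> gradient w z = - 2 * real q * (reg e (Suc q) z * (w z * (z \<bullet> gradient w z)))
      + reg e q z * (norm (gradient w z))\<^sup>2" for z
  proof -
    have "gradient f z \<bullet> i = dir_deriv i f z" if "i \<in> Basis" for i
      using that unfolding gradient_def by (rule inner_sum_left_Basis)
    then have "gradient f z \<bullet> gradient w z = (\<Sum>i\<in>Basis. dir_deriv i f z * dir_deriv i w z)"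
      unfolding inner_gradient by simp
    then show ?thesis
      unfolding D norm_gradient inner_gradient
      by (simp add: algebra_simps power2_eq_square sum.distrib sum_subtractf sum_distrib_left sum_negf del: inner_prod_def)
  qed
  then have "f z * Delta_b b w z + gradient f z \<bullet> gradient w z
      = reg e q z * (w z * Delta_b b w z)
        - 2 * real q * (reg e (Suc q) z * (w z * (z \<bullet> gradient w z)))
        + reg e q z * (norm (gradient w z))\<^sup>2" for z
    by (simp add: f_def)
  then show ?thesis
    using integral_green[OF b w Ckf] integrable_terms by simp
qed

lemma hardy_reg:
  assumes "0 \<le> real CARD('n) + 1 + b - 2"
  shows "((real CARD('n) + 1 + b - 2) / 2)\<^sup>2 * (\<integral>z. reg e 1 z * (w z)\<^sup>2 \<partial>mu b)
    \<le> (\<integral>z. (norm (gradient w z))\<^sup>2 \<partial>mu b)"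
proof -
  \<comment> \<open>The optimal s: with 2S <= -2s I, the bound -2s S - s^2 I is at least (2s^2 -
    s^2) I.\<close>
  define s where "s = (real CARD('n) + 1 + b - 2) / 2"
  define S where "S = (\<integral>z. reg e 1 z * (w z * (z \<bullet> gradient w z)) \<partial>mu b)"
  define I where "I = (\<integral>z. reg e 1 z * (w z)\<^sup>2 \<partial>mu b)"
  have "- 2 * s * S - s\<^sup>2 * I \<le> (\<integral>z. (norm (gradient w z))\<^sup>2 \<partial>mu b)"
    using integral_reg_gradient_ge[of s 0] by (simp add: S_def I_def reg_def[of _ 0])
  moreover have "2 * S \<le> - (2 * s) * I"
  proof -
    have "2 * s = real CARD('n) + 1 + b - 2 * real (1 :: nat)" by (simp add: s_def)
    then show ?thesis using integral_reg_radial_le[of 1] unfolding S_def I_def by (simp only:)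
  qed
  then have "s * (2 * S) \<le> s * (- (2 * s) * I)"
    using assms by (intro mult_left_mono) (auto simp: s_def)
  ultimately show ?thesis
    unfolding s_def[symmetric] I_def[symmetric] by (simp add: power2_eq_square algebra_simps)
qed

lemma rellich_reg:
  assumes N: "0 \<le> real CARD('n) + 1 + b - 4 - 2 * real q"
  shows "((real CARD('n) + 1 + b - 4 - 2 * real q) * (real CARD('n) + 1 + b + 2 * real q) / 4)\<^sup>2
      * (\<integral>z. reg e (q + 2) z * (w z)\<^sup>2 \<partial>mu b)
    \<le> (\<integral>z. reg e q z * (Delta_b b w z)\<^sup>2 \<partial>mu b)"
proof -
  \<comment> \<open>Chosen so that 2s = N - 2(q + 2), the coefficient in
    \<open>integral_reg_radial_le\<close> for p = q + 2. Then c = s (N - 2 - s), and formally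
    \<open>Delta_b\<close> maps |z|^(-s) to -c |z|^(-s-2).\<close>
  define s where "s = (real CARD('n) + 1 + b - 4 - 2 * real q) / 2"
  define c where "c = s * (s + 2 * real (Suc q))"
  define S where "S = (\<integral>z. reg e (q + 2) z * (w z * (z \<bullet> gradient w z)) \<partial>mu b)"
  define I where "I = (\<integral>z. reg e (q + 2) z * (w z)\<^sup>2 \<partial>mu b)"
  define A where "A = (\<integral>z. reg e (Suc q) z * (w z * Delta_b b w z) \<partial>mu b)"
  have s: "0 \<le> s" using N by (simp add: s_def)
  have c: "0 \<le> c" using s by (simp add: c_def)
  \<comment> \<open>Green's formula at level q + 1 expresses the weighted integral of |grad w|^2 as
    2(q + 1) S - A, so the first square becomes an upper bound for A.\<close>
  have "- 2 * s * S - s\<^sup>2 * I \<le> 2 * real (Suc q) * S - A"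
    using integral_reg_gradient_ge[of s "Suc q"] integral_reg_green[of "Suc q"]
    by (simp add: S_def I_def A_def)
  moreover have "2 * S \<le> - (2 * s) * I"
  proof -
    have "2 * s = real CARD('n) + 1 + b - 2 * real (q + 2)" by (simp add: s_def)
    then show ?thesis using integral_reg_radial_le[of "q + 2"] unfolding S_def I_def by (simp only:)
  qed
  then have "(s + real (Suc q)) * (2 * S) \<le> (s + real (Suc q)) * (- (2 * s) * I)"
    using s by (intro mult_left_mono) auto
  ultimately have A: "A \<le> - c * I"
    by (simp add: c_def power2_eq_square algebra_simps)
  \<comment> \<open>The second square, of (z . z + e) \<open>Delta_b b w\<close> + c w against
    \<open>reg e (q + 2)\<close>. Since A <= -c I, its cross term is at most -2 c^2 I, which leaves
    c^2 I as the lower bound.\<close>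
  have "0 \<le> (\<integral>z. reg e q z * (Delta_b b w z)\<^sup>2 + 2 * c * (reg e (Suc q) z * (w z * Delta_b b w z))
      + c\<^sup>2 * (reg e (q + 2) z * (w z)\<^sup>2) \<partial>mu b)"
  proof (rule Bochner_Integration.integral_nonneg)
    fix z
    have "0 \<le> reg e (q + 2) z * ((z \<bullet> z + e) * Delta_b b w z + c * w z)\<^sup>2"
      using reg_pos[OF e, of "q + 2" z] by simp
    then show "0 \<le> reg e q z * (Delta_b b w z)\<^sup>2 + 2 * c * (reg e (Suc q) z * (w z * Delta_b b w z))
      + c\<^sup>2 * (reg e (q + 2) z * (w z)\<^sup>2)"
      using reg_Suc[OF e, of q z] reg_Suc[OF e, of "Suc q" z]
      by (simp add: power2_eq_square algebra_simps)
  qed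
  then have "0 \<le> (\<integral>z. reg e q z * (Delta_b b w z)\<^sup>2 \<partial>mu b) + 2 * c * A + c\<^sup>2 * I"
    using integrable_terms by (simp add: A_def I_def)
  moreover have "c * A \<le> c * (- c * I)" using A c by (rule mult_left_mono)
  moreover have "(real CARD('n) + 1 + b - 4 - 2 * real q) * (real CARD('n) + 1 + b + 2 * real q) / 4 = c"
    by (simp add: c_def s_def field_simps)
  ultimately show ?thesis
    unfolding I_def[symmetric] by (simp add: power2_eq_square algebra_simps)
qed

end

text \<open>Induction in steps of two, one \<open>Delta_b\<close> at a time:
  \<open>rellich_reg\<close> with q = k passes from w to \<open>Delta_b b w\<close> and lowers the
  weight from k + 2 to k, where the hypothesis takes over. Base cases are equality for k = 0 and
  Hardy's inequality for k = 1.\<close>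

lemma rellich_nabla_reg:
  fixes w :: "'n::finite pt \<Rightarrow> real"
  assumes b: "- 1 < b" and e: "0 < e" and w: "w \<in> Cinf_c_even"
    and N: "0 < real CARD('n) + 1 + b - 2 * real k"
  shows "(2 ^ k * pochhammer ((real CARD('n) + 1 + b - 2 * real k) / 4) k)\<^sup>2
      * (\<integral>z. reg e k z * (w z)\<^sup>2 \<partial>mu b)
    \<le> (\<integral>z. (norm (nabla_b b k w z))\<^sup>2 \<partial>mu b)"
  using w N
proof (induction k arbitrary: w rule: nat_induct2)
  case (0 w)
  then show ?case by (simp add: nabla_b_def reg_def[of _ 0])
next
  case (1 w)
  have "2 ^ 1 * pochhammer ((real CARD('n) + 1 + b - 2 * real (1 :: nat)) / 4) 1
      = (real CARD('n) + 1 + b - 2) / 2"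
    by simp
  moreover have "norm (nabla_b b 1 w z) = norm (gradient w z)" for z
    by (simp add: nabla_b_def)
  ultimately show ?case using hardy_reg[OF b e 1(1)] 1(2) by (simp only:)
next
  case (step k w)
  let ?N = "real CARD('n) + 1 + b"
  \<comment> \<open>Lowering k + 2 to k raises the starting point of the rising product from a to a
    + 1.\<close>
  define a where "a = (?N - 2 * real (k + 2)) / 4"
  have Na: "?N = 4 * a + 2 * real (k + 2)"
  proof -
    have "x = 4 * ((x - y) / 4) + y" for x y :: real by (simp add: field_simps)
    then show ?thesis unfolding a_def .
  qed
  let ?P = "2 ^ k * pochhammer (a + 1) k"
  have "(2 ^ (k + 2) * pochhammer a (k + 2))\<^sup>2 = ?P\<^sup>2 * ((?N - 4 - 2 * real k) * (?N + 2 * real k) / 4)\<^sup>2"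
  proof -
    have "pochhammer a (k + 2) = a * (pochhammer (a + 1) k * (a + 1 + real k))"
      by (simp only: add_2_eq_Suc' pochhammer_rec[of a] pochhammer_Suc[of "a + 1"])
    moreover have "(?N - 4 - 2 * real k) * (?N + 2 * real k) / 4 = 4 * (a * (a + 1 + real k))"
      unfolding Na by (simp add: field_simps)
    ultimately have "2 ^ (k + 2) * pochhammer a (k + 2) = ?P * ((?N - 4 - 2 * real k) * (?N + 2 * real k) / 4)"
      by (simp only:) (simp add: power_add)
    then show ?thesis by (simp only: power_mult_distrib)
  qed
  then have "(2 ^ (k + 2) * pochhammer a (k + 2))\<^sup>2 * (\<integral>z. reg e (k + 2) z * (w z)\<^sup>2 \<partial>mu b)
      = ?P\<^sup>2 * (((?N - 4 - 2 * real k) * (?N + 2 * real k) / 4)\<^sup>2 * (\<integral>z. reg e (k + 2) z * (w z)\<^sup>2 \<partial>mu b))"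
    by (simp only: mult.assoc)
  also have "\<dots> \<le> ?P\<^sup>2 * (\<integral>z. reg e k z * (Delta_b b w z)\<^sup>2 \<partial>mu b)"
    using step.prems by (intro mult_left_mono rellich_reg b e) auto
  also have "\<dots> \<le> (\<integral>z. (norm (nabla_b b k (Delta_b b w) z))\<^sup>2 \<partial>mu b)"
  proof -
    have eq: "a + 1 = (?N - 2 * real k) / 4" by (simp add: a_def field_simps)
    have "0 < ?N - 2 * real k" using step.prems(2) by simp
    then show ?thesis
      unfolding eq by (rule step.IH[OF Delta_b_Cinf_c_even[OF step.prems(1)]])
  qed
  also have "nabla_b b k (Delta_b b w) = nabla_b b (k + 2) w"
  proof (cases "even k")
    case True
    then have "(k + 2) div 2 = Suc (k div 2)" by simp
    then show ?thesis using True by (simp add: nabla_b_def funpow_Suc_right del: funpow.simps)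
  next
    case False
    then have "(k + 2 - 1) div 2 = Suc ((k - 1) div 2)" by presburger
    then show ?thesis using False by (simp add: nabla_b_def funpow_Suc_right del: funpow.simps)
  qed
  finally show ?case unfolding a_def .
qed

subsection \<open>Passage to the completion\<close>

lemma nn_integral_limit_le:
  fixes f :: "nat \<Rightarrow> 'a \<Rightarrow> ennreal"
  assumes "\<And>m. f m \<in> borel_measurable M" "AE x in M. (\<lambda>m. f m x) \<longlonglongrightarrow> g x"
    and "\<And>m. integral\<^sup>N M (f m) \<le> D"
  shows "integral\<^sup>N M g \<le> D"
proof -
  have "AE x in M. g x = liminf (\<lambda>m. f m x)"
    using assms(2) by eventually_elim (metis lim_imp_Liminf trivial_limit_sequentially)
  then have "integral\<^sup>N M g = (\<integral>\<^sup>+x. liminf (\<lambda>m. f m x) \<partial>M)"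
    by (rule nn_integral_cong_AE)
  also have "\<dots> \<le> liminf (\<lambda>m. integral\<^sup>N M (f m))"
    by (rule nn_integral_liminf) (rule assms)
  also have "\<dots> \<le> liminf (\<lambda>m. D)"
    by (rule Liminf_mono) (simp add: assms)
  also have "\<dots> = D" by (simp add: Liminf_const)
  finally show ?thesis .
qed

text \<open>The factor 2^j makes a bound on squares sufficient: the terms are eventually below 1, so
  the increments are dominated by a geometric series.\<close>

lemma convergent_fast_Cauchy:
  fixes X :: "nat \<Rightarrow> 'c::banach"
  assumes "summable (\<lambda>j. (2 ^ j * norm (X (Suc j) - X j))\<^sup>2)"
  shows "convergent X"
proof -
  let ?d = "\<lambda>j. norm (X (Suc j) - X j)"
  have "(\<lambda>j. (2 ^ j * ?d j)\<^sup>2) \<longlonglongrightarrow> 0" by (rule summable_LIMSEQ_zero[OF assms])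
  then have "\<forall>\<^sub>F j in sequentially. (2 ^ j * ?d j)\<^sup>2 < 1" by (rule order_tendstoD) simp
  then obtain K where K: "\<And>j. K \<le> j \<Longrightarrow> (2 ^ j * ?d j)\<^sup>2 < 1"
    by (auto simp: eventually_sequentially)
  have "?d j \<le> (1 / 2) ^ j" if "K \<le> j" for j
  proof -
    have "\<bar>2 ^ j * ?d j\<bar> < 1" using K[OF that] by (simp only: abs_square_less_1)
    then have "2 ^ j * ?d j < 1" by linarith
    then show ?thesis by (simp add: power_one_over field_simps)
  qed
  then have "summable (\<lambda>j. X (Suc j) - X j)"
    by (intro summable_comparison_test[of "\<lambda>j. X (Suc j) - X j" "\<lambda>j. (1 / 2) ^ j"] summable_geometric) auto
  then have "convergent (\<lambda>n. \<Sum>j<n. X (Suc j) - X j)" by (simp add: summable_iff_convergent)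
  then have "convergent (\<lambda>n. (X n - X 0) + X 0)"
    unfolding sum_lessThan_telescope by (intro convergent_add convergent_const)
  then show ?thesis by simp
qed

text \<open>Riesz-Fischer for Banach-valued functions, phrased with extended nonnegative integrals
  so that it matches \<open>wL2_sq\<close>.\<close>

lemma L2_complete:
  fixes F :: "nat \<Rightarrow> 'a \<Rightarrow> 'c::{banach, second_countable_topology}"
  assumes F[measurable]: "\<And>m. F m \<in> borel_measurable M"
    and Cauchy: "\<And>e. 0 < e \<Longrightarrow> \<exists>K. \<forall>m\<ge>K. \<forall>p\<ge>K. (\<integral>\<^sup>+x. ennreal ((norm (F m x - F p x))\<^sup>2) \<partial>M) < e"
  obtains G where "G \<in> borel_measurable M"
    "(\<lambda>m. \<integral>\<^sup>+x. ennreal ((norm (F m x - G x))\<^sup>2) \<partial>M) \<longlonglongrightarrow> 0"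
proof -
  \<comment> \<open>The rate 8^(-j) absorbs the factor 4^j = (2^j)^2 in \<open>g\<close> and leaves
    the summable 2^(-j).\<close>
  have "\<exists>K. \<forall>m\<ge>K. \<forall>p\<ge>K. (\<integral>\<^sup>+x. ennreal ((norm (F m x - F p x))\<^sup>2) \<partial>M) < ennreal ((1 / 8) ^ j)" for j
    by (rule Cauchy) simp
  then obtain K where K: "\<And>j m p. K j \<le> m \<Longrightarrow> K j \<le> p \<Longrightarrow>
      (\<integral>\<^sup>+x. ennreal ((norm (F m x - F p x))\<^sup>2) \<partial>M) < ennreal ((1 / 8) ^ j)"
    by metis
  \<comment> \<open>Partial sums make r monotone and at least \<open>K j\<close>; the summand j
    makes it unbounded.\<close>
  define r where "r j = (\<Sum>i\<le>j. K i) + j" for j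
  have r_ge: "K j \<le> r j" "j \<le> r j" "r j \<le> r (Suc j)" for j
    using member_le_sum[of j "{..j}" K] by (auto simp: r_def)
  define g where "g j x = ennreal ((2 ^ j * norm (F (r (Suc j)) x - F (r j) x))\<^sup>2)" for j x
  have [measurable]: "g j \<in> borel_measurable M" for j unfolding g_def by measurable
  have g_le: "integral\<^sup>N M (g j) \<le> ennreal ((1 / 2) ^ j)" for j
  proof -
    have "integral\<^sup>N M (g j) = ennreal (4 ^ j) * (\<integral>\<^sup>+x. ennreal ((norm (F (r (Suc j)) x - F (r j) x))\<^sup>2) \<partial>M)"
      unfolding g_def power_mult_distrib power_mult[symmetric]
      by (subst nn_integral_cmult[symmetric])
         (auto simp: ennreal_mult[symmetric] power_mult mult.commute[of _ 2])
    also have "\<dots> \<le> ennreal (4 ^ j) * ennreal ((1 / 8) ^ j)"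
      using K[of j "r (Suc j)" "r j"] r_ge[of j] by (intro mult_left_mono) auto
    also have "\<dots> = ennreal ((4 * (1 / 8)) ^ j)"
      unfolding power_mult_distrib by (subst ennreal_mult) auto
    finally show ?thesis by simp
  qed
  have "(\<integral>\<^sup>+x. (\<Sum>j. g j x) \<partial>M) = (\<Sum>j. integral\<^sup>N M (g j))"
    by (rule nn_integral_suminf) measurable
  also have "\<dots> \<le> (\<Sum>j. ennreal ((1 / 2) ^ j))"
    by (intro suminf_le g_le) auto
  also have "\<dots> = ennreal (\<Sum>j. (1 / 2) ^ j)"
    by (rule suminf_ennreal2) auto
  finally have "(\<integral>\<^sup>+x. (\<Sum>j. g j x) \<partial>M) \<noteq> \<infinity>" by (auto simp: top_unique)
  then have "AE x in M. (\<Sum>j. g j x) \<noteq> \<infinity>"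
    by (intro nn_integral_noteq_infinite) auto
  then have conv: "AE x in M. convergent (\<lambda>j. F (r j) x)"
  proof eventually_elim
    case (elim x)
    then have "summable (\<lambda>j. (2 ^ j * norm (F (r (Suc j)) x - F (r j) x))\<^sup>2)"
      unfolding g_def by (intro summable_suminf_not_top) auto
    then show ?case by (rule convergent_fast_Cauchy)
  qed
  \<comment> \<open>Where the subsequence diverges, \<open>lim\<close> has an arbitrary value, but
    only on a null set.\<close>
  define G where "G x = lim (\<lambda>j. F (r j) x)" for x
  have G[measurable]: "G \<in> borel_measurable M"
    unfolding G_def by (rule borel_measurable_lim_metric) (rule F)
  \<comment> \<open>Fatou's lemma as p runs through the subsequence; the shift by L keeps all its
    indices at least L.\<close>
  have lim_le: "(\<integral>\<^sup>+x. ennreal ((norm (F m x - G x))\<^sup>2) \<partial>M) \<le> e"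
    if L: "\<And>p. L \<le> p \<Longrightarrow> (\<integral>\<^sup>+x. ennreal ((norm (F m x - F p x))\<^sup>2) \<partial>M) \<le> e" for m L e
  proof (rule nn_integral_limit_le[where f = "\<lambda>j x. ennreal ((norm (F m x - F (r (j + L)) x))\<^sup>2)"])
    show "AE x in M. (\<lambda>j. ennreal ((norm (F m x - F (r (j + L)) x))\<^sup>2)) \<longlonglongrightarrow> ennreal ((norm (F m x - G x))\<^sup>2)"
      using conv
    proof eventually_elim
      case (elim x)
      then have "(\<lambda>j. F (r j) x) \<longlonglongrightarrow> G x" unfolding G_def by (rule convergent_LIMSEQ_iff[THEN iffD1])
      then have "(\<lambda>j. F (r (j + L)) x) \<longlonglongrightarrow> G x" by (rule LIMSEQ_ignore_initial_segment)
      then show ?case by (intro tendsto_intros)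
    qed
    show "(\<integral>\<^sup>+x. ennreal ((norm (F m x - F (r (j + L)) x))\<^sup>2) \<partial>M) \<le> e" for j
      by (rule L) (use r_ge(2)[of "j + L"] in linarith)
  qed measurable
  have "(\<lambda>m. \<integral>\<^sup>+x. ennreal ((norm (F m x - G x))\<^sup>2) \<partial>M) \<longlonglongrightarrow> 0"
  proof (rule order_tendstoI)
    fix a :: ennreal assume "0 < a"
    then obtain e where e: "0 < e" "e < a" using dense by blast
    obtain L where L: "\<forall>m\<ge>L. \<forall>p\<ge>L. (\<integral>\<^sup>+x. ennreal ((norm (F m x - F p x))\<^sup>2) \<partial>M) < e"
      using Cauchy[OF e(1)] by blast
    have "(\<integral>\<^sup>+x. ennreal ((norm (F m x - G x))\<^sup>2) \<partial>M) < a" if "L \<le> m" for m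
      using lim_le[of L m e] L that e(2) by (meson le_less_trans less_imp_le)
    then show "\<forall>\<^sub>F m in sequentially. (\<integral>\<^sup>+x. ennreal ((norm (F m x - G x))\<^sup>2) \<partial>M) < a"
      by (auto simp: eventually_sequentially)
  qed auto
  with G that show ?thesis by blast
qed

section \<open>Weighted square integrals\<close>

lemma borel_measurable_wt[measurable]: "(wt b i :: 'n::finite pt \<Rightarrow> real) \<in> borel_measurable borel"
  unfolding wt_def by measurable

lemma wt_nonneg: "0 \<le> wt b i z"
  by (simp add: wt_def)

lemma borel_measurable_lebesgueI:
  "f \<in> borel_measurable borel \<Longrightarrow> f \<in> borel_measurable lebesgue"
  by (simp add: measurable_completion)

lemma wL2_sq_density:
  assumes "F \<in> borel_measurable lebesgue"
  shows "wL2_sq b i F = (\<integral>\<^sup>+z. ennreal ((norm (F z))\<^sup>2) \<partial>density lebesgue (\<lambda>z. ennreal (wt b i z)))"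
proof -
  have [measurable]: "wt b i \<in> borel_measurable lebesgue"
    by (intro borel_measurable_lebesgueI borel_measurable_wt)
  show ?thesis
    unfolding wL2_sq_def using assms
    by (subst nn_integral_density) (auto simp: ennreal_mult wt_nonneg)
qed

text \<open>Triangle inequality for squares, with a factor arbitrarily close to 1 on one side, so
  that the sharp constant survives the limit. The added square in the proof makes the cross terms
  cancel.\<close>

lemma square_norm_add_le:
  fixes x y :: "'c::real_normed_vector"
  assumes d: "0 < d"
  shows "(norm x)\<^sup>2 \<le> (1 + d) * (norm y)\<^sup>2 + (1 + 1 / d) * (norm (x - y))\<^sup>2"
proof -
  have "norm x \<le> norm y + norm (x - y)" using norm_triangle_ineq[of y "x - y"] by simp
  then have "(norm x)\<^sup>2 \<le> (norm y + norm (x - y))\<^sup>2" by (intro power_mono) auto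
  also have "\<dots> \<le> (norm y + norm (x - y))\<^sup>2 + (d * norm y - norm (x - y))\<^sup>2 / d"
    using d by simp
  also have "\<dots> = (1 + d) * (norm y)\<^sup>2 + (1 + 1 / d) * (norm (x - y))\<^sup>2"
    using d by (simp add: power2_eq_square field_simps)
  finally show ?thesis .
qed

lemma wL2_sq_add_le:
  fixes F G :: "'n::finite pt \<Rightarrow> 'c::{real_normed_vector, second_countable_topology}"
  assumes F[measurable]: "F \<in> borel_measurable lebesgue" and G[measurable]: "G \<in> borel_measurable lebesgue"
    and d: "0 < d"
  shows "wL2_sq b i F \<le> ennreal (1 + d) * wL2_sq b i G + ennreal (1 + 1 / d) * wL2_sq b i (\<lambda>z. F z - G z)"
proof -
  let ?M = "density lebesgue (\<lambda>z. ennreal (wt b i z)) :: 'n pt measure"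
  have "wL2_sq b i F \<le> (\<integral>\<^sup>+z. ennreal (1 + d) * ennreal ((norm (G z))\<^sup>2)
      + ennreal (1 + 1 / d) * ennreal ((norm (F z - G z))\<^sup>2) \<partial>?M)"
    unfolding wL2_sq_density[OF F]
    using d square_norm_add_le[OF d]
    by (intro nn_integral_mono) (simp add: ennreal_mult[symmetric] ennreal_plus[symmetric] del: ennreal_plus)
  also have "\<dots> = ennreal (1 + d) * wL2_sq b i G + ennreal (1 + 1 / d) * wL2_sq b i (\<lambda>z. F z - G z)"
    using wL2_sq_density[OF G, of b i] wL2_sq_density[of "\<lambda>z. F z - G z" b i]
    by (simp add: nn_integral_add nn_integral_cmult)
  finally show ?thesis .
qed

lemma wL2_sq_minus_commute: "wL2_sq b i (\<lambda>z. F z - G z) = wL2_sq b i (\<lambda>z. G z - F z)"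
  by (simp add: wL2_sq_def norm_minus_commute)

lemma nn_integral_mu:
  assumes "f \<in> borel_measurable borel" "\<And>z. 0 \<le> f z"
  shows "(\<integral>\<^sup>+z. ennreal (f z) \<partial>mu b) = (\<integral>\<^sup>+z. ennreal (\<bar>snd z\<bar> powr b * f z) \<partial>lborel)"
  unfolding mu_def using assms by (subst nn_integral_density) (auto simp: ennreal_mult)

lemma wL2_sq_eq_integral_mu:
  fixes F :: "'n::finite pt \<Rightarrow> 'c::{real_normed_vector, second_countable_topology}"
  assumes b: "- 1 < b" and F: "continuous_on UNIV F" "vanishes_far F"
  shows "wL2_sq b 0 F = ennreal (\<integral>z. (norm (F z))\<^sup>2 \<partial>mu b)"
proof -
  have c: "continuous_on UNIV (\<lambda>z. (norm (F z))\<^sup>2)" by (intro continuous_intros F)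
  have "wL2_sq b 0 F = (\<integral>\<^sup>+z. ennreal (\<bar>snd z\<bar> powr b * (norm (F z))\<^sup>2) \<partial>lborel)"
    unfolding wL2_sq_def nn_integral_completion by (simp add: wt_def)
  also have "\<dots> = (\<integral>\<^sup>+z. ennreal ((norm (F z))\<^sup>2) \<partial>mu b)"
    by (subst nn_integral_mu) (auto intro: borel_measurable_continuous_onI c)
  also have "\<dots> = ennreal (\<integral>z. (norm (F z))\<^sup>2 \<partial>mu b)"
    by (intro nn_integral_eq_integral integrable_mu b c vanishes_far_mono[OF F(2)]) auto
  finally show ?thesis .
qed

text \<open>The right-hand side of \<open>rellich_nabla_reg\<close> does not depend on e, so Fatou's
  lemma along e = 1/(m + 1) yields the singular weight; finiteness of its integral against w^2 is
  part of the result.\<close>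

lemma rellich_nabla:
  fixes w :: "'n::finite pt \<Rightarrow> real"
  assumes b: "- 1 < b" and w: "w \<in> Cinf_c_even" and N: "0 < real CARD('n) + 1 + b - 2 * real k"
  shows "ennreal ((2 ^ k * pochhammer ((real CARD('n) + 1 + b - 2 * real k) / 4) k)\<^sup>2) * wL2_sq b k w
    \<le> wL2_sq b 0 (nabla_b b k w)"
proof -
  define C where "C = (2 ^ k * pochhammer ((real CARD('n) + 1 + b - 2 * real k) / 4) k)\<^sup>2"
  define B where "B = (\<integral>z. (norm (nabla_b b k w z))\<^sup>2 \<partial>mu b)"
  have C: "0 < C" using N pochhammer_pos[of "(real CARD('n) + 1 + b - 2 * real k) / 4" k]
    by (simp add: C_def)
  have sw: "continuous_on UNIV w" "vanishes_far w"
    using w by (auto simp: Cinf_c_even_iff Cinf_continuous)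
  define e where "e m = inverse (real (Suc m))" for m
  have e: "0 < e m" for m by (simp add: e_def)
  have e0: "e \<longlonglongrightarrow> 0" unfolding e_def by (rule LIMSEQ_inverse_real_of_nat)
  have c: "continuous_on UNIV (\<lambda>z. reg (e m) k z * (w z)\<^sup>2)" for m
    by (intro continuous_intros continuous_on_reg e sw)
  have [measurable]: "(\<lambda>z. reg (e m) k z * (w z)\<^sup>2) \<in> borel_measurable borel" for m
    by (intro borel_measurable_continuous_onI c)
  have "wL2_sq b k w \<le> ennreal (B / C)"
    unfolding wL2_sq_def nn_integral_completion
  proof (rule nn_integral_limit_le[where f = "\<lambda>m z. ennreal (\<bar>snd z\<bar> powr b * (reg (e m) k z * (w z)\<^sup>2))"])
    show "(\<lambda>z. ennreal (\<bar>snd z\<bar> powr b * (reg (e m) k z * (w z)\<^sup>2))) \<in> borel_measurable lborel" for m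
      by measurable
    show "AE z in lborel. (\<lambda>m. ennreal (\<bar>snd z\<bar> powr b * (reg (e m) k z * (w z)\<^sup>2)))
        \<longlonglongrightarrow> ennreal (wt b k z * (norm (w z))\<^sup>2)"
    proof (rule AE_I2)
      fix z :: "'n pt"
      show "(\<lambda>m. ennreal (\<bar>snd z\<bar> powr b * (reg (e m) k z * (w z)\<^sup>2)))
        \<longlonglongrightarrow> ennreal (wt b k z * (norm (w z))\<^sup>2)"
      proof (cases "z = 0")
        \<comment> \<open>At the origin both sides vanish, because 0 \<open>powr\<close> b is 0 in
          HOL.\<close>
        case True
        then show ?thesis by (simp add: wt_def)
      next
        case False
        then have ne: "z \<bullet> z + 0 \<noteq> 0" by (simp only: add_0_right inner_eq_zero_iff not_False_eq_True)
        have "(\<lambda>m. ennreal (\<bar>snd z\<bar> powr b * (inverse (z \<bullet> z + e m) ^ k * (w z)\<^sup>2)))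
          \<longlonglongrightarrow> ennreal (\<bar>snd z\<bar> powr b * (inverse (z \<bullet> z + 0) ^ k * (w z)\<^sup>2))"
          by (intro tendsto_intros e0 ne)
        moreover have "wt b k z = \<bar>snd z\<bar> powr b * inverse (z \<bullet> z) ^ k"
          by (simp only: wt_def power_mult power2_norm_eq_inner divide_inverse power_inverse)
        ultimately show ?thesis by (simp add: reg_def mult.assoc del: inner_prod_def)
      qed
    qed
    fix m
    have "(\<integral>\<^sup>+z. ennreal (\<bar>snd z\<bar> powr b * (reg (e m) k z * (w z)\<^sup>2)) \<partial>lborel)
        = (\<integral>\<^sup>+z. ennreal (reg (e m) k z * (w z)\<^sup>2) \<partial>mu b)"
      by (subst nn_integral_mu) (auto intro!: mult_nonneg_nonneg less_imp_le[OF reg_pos[OF e]])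
    also have "\<dots> = ennreal (\<integral>z. reg (e m) k z * (w z)\<^sup>2 \<partial>mu b)"
      by (intro nn_integral_eq_integral integrable_mu b c vanishes_far_mono[OF sw(2)])
         (auto intro!: mult_nonneg_nonneg less_imp_le[OF reg_pos[OF e]])
    also have "\<dots> \<le> ennreal (B / C)"
      using rellich_nabla_reg[OF b e w N, of m] C
      unfolding C_def[symmetric] B_def[symmetric] by (intro ennreal_leI) (simp add: field_simps)
    finally show "(\<integral>\<^sup>+z. ennreal (\<bar>snd z\<bar> powr b * (reg (e m) k z * (w z)\<^sup>2)) \<partial>lborel) \<le> ennreal (B / C)" .
  qed
  then have "ennreal C * wL2_sq b k w \<le> ennreal C * ennreal (B / C)"
    by (rule mult_left_mono) simp
  also have "\<dots> = ennreal B"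
  proof -
    have "0 \<le> B" unfolding B_def by (rule Bochner_Integration.integral_nonneg) simp
    then show ?thesis using C by (subst ennreal_mult[symmetric]) auto
  qed
  also have "\<dots> = wL2_sq b 0 (nabla_b b k w)"
    unfolding B_def
    by (rule wL2_sq_eq_integral_mu[OF b continuous_on_nabla_b[OF w] vanishes_far_nabla_b[OF w], symmetric])
  finally show ?thesis unfolding C_def .
qed

lemma nabla_b_measurable:
  "U \<in> Cinf_c_even \<Longrightarrow> nabla_b b j U \<in> borel_measurable lebesgue"
  by (intro borel_measurable_lebesgueI borel_measurable_continuous_onI continuous_on_nabla_b)

text \<open>Justifies the use of \<open>SOME\<close> in \<open>nabla_D\<close>. Only the top order j
  = k is treated, where the power of |z| in the weight is trivial; the Cauchy property is that of
  the summand j = k of \<open>D_norm_sq\<close>.\<close>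

lemma ex_is_nabla_D:
  fixes U :: "'n::finite pt \<Rightarrow> real"
  assumes b: "- 1 < b" and U: "U \<in> D_even k b"
  shows "\<exists>G. is_nabla_D k b k U G"
proof -
  obtain V where V: "D_approx k b V U" using U by (auto simp: D_even_def)
  then have VE: "\<And>m. V m \<in> Cinf_c_even"
    and VC: "\<And>e. 0 < e \<Longrightarrow> \<exists>M. \<forall>m\<ge>M. \<forall>p\<ge>M. D_norm_sq k b (\<lambda>z. V m z - V p z) < e"
    by (auto simp: D_approx_def)
  let ?M = "density lebesgue (\<lambda>z. ennreal (wt b 0 z)) :: 'n pt measure"
  let ?F = "\<lambda>m. nabla_b b k (V m)"
  have [measurable]: "?F m \<in> borel_measurable lebesgue" for m
    by (rule nabla_b_measurable[OF VE])
  have diff: "wL2_sq b 0 (\<lambda>z. ?F m z - ?F p z) \<le> D_norm_sq k b (\<lambda>z. V m z - V p z)" for m p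
  proof -
    have "wL2_sq b 0 (\<lambda>z. ?F m z - ?F p z) = wL2_sq b (k - k) (nabla_b b k (\<lambda>z. V m z - V p z))"
      by (simp add: nabla_b_diff[OF VE VE] wL2_sq_def)
    also have "\<dots> \<le> D_norm_sq k b (\<lambda>z. V m z - V p z)"
      unfolding D_norm_sq_def by (rule member_le_sum[where f = "\<lambda>j. wL2_sq b (k - j) (nabla_b b j (\<lambda>z. V m z - V p z))"]) auto
    finally show ?thesis .
  qed
  obtain G where G: "G \<in> borel_measurable ?M"
    "(\<lambda>m. \<integral>\<^sup>+z. ennreal ((norm (?F m z - G z))\<^sup>2) \<partial>?M) \<longlonglongrightarrow> 0"
  proof (rule L2_complete[where F = ?F and M = ?M])
    fix e :: ennreal assume "0 < e"
    from VC[OF this] obtain K where "\<forall>m\<ge>K. \<forall>p\<ge>K. D_norm_sq k b (\<lambda>z. V m z - V p z) < e" by blast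
    then have "\<forall>m\<ge>K. \<forall>p\<ge>K. wL2_sq b 0 (\<lambda>z. ?F m z - ?F p z) < e"
      using diff le_less_trans by blast
    then show "\<exists>K. \<forall>m\<ge>K. \<forall>p\<ge>K. (\<integral>\<^sup>+z. ennreal ((norm (?F m z - ?F p z))\<^sup>2) \<partial>?M) < e"
      by (subst (asm) wL2_sq_density) auto
  qed auto
  have Gm[measurable]: "G \<in> borel_measurable lebesgue" using G(1) by simp
  have lim: "(\<lambda>m. wL2_sq b 0 (\<lambda>z. ?F m z - G z)) \<longlonglongrightarrow> 0"
    using G(2) by (subst wL2_sq_density) auto
  have "\<forall>\<^sub>F m in sequentially. wL2_sq b 0 (\<lambda>z. ?F m z - G z) < 1"
    using lim by (rule order_tendstoD) simp
  then obtain m where m: "wL2_sq b 0 (\<lambda>z. ?F m z - G z) < 1"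
    by (auto simp: eventually_sequentially)
  \<comment> \<open>Finiteness for G comes from a single approximant at distance less than
    1.\<close>
  have "wL2_sq b 0 G \<le> ennreal (1 + 1) * wL2_sq b 0 (?F m) + ennreal (1 + 1 / 1) * wL2_sq b 0 (\<lambda>z. ?F m z - G z)"
    using wL2_sq_add_le[of G "?F m" 1 b 0] by (simp add: wL2_sq_minus_commute[of b 0 G])
  also have "\<dots> < \<infinity>"
  proof -
    have "wL2_sq b 0 (?F m) < \<infinity>"
      by (simp add: wL2_sq_eq_integral_mu[OF b continuous_on_nabla_b[OF VE] vanishes_far_nabla_b[OF VE]])
    moreover have "wL2_sq b 0 (\<lambda>z. ?F m z - G z) < \<infinity>" using m by (rule less_trans) simp
    ultimately show ?thesis by (simp add: ennreal_mult_less_top)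
  qed
  finally have "G \<in> wL2 b 0" by (simp add: wL2_def)
  then show ?thesis unfolding is_nabla_D_def using V lim by auto
qed

text \<open>The sequence V contained in \<open>is_nabla_D\<close> converges to U and has derivatives
  converging to G simultaneously; hence the bound holds for every admissible G, whichever one
  \<open>SOME\<close> selects.\<close>

lemma rellich_is_nabla_D:
  fixes U :: "'n::finite pt \<Rightarrow> real"
  assumes b: "- 1 < b" and U: "U \<in> D_even k b" and G: "is_nabla_D k b k U G"
    and N: "0 < real CARD('n) + 1 + b - 2 * real k"
  shows "ennreal ((2 ^ k * pochhammer ((real CARD('n) + 1 + b - 2 * real k) / 4) k)\<^sup>2) * wL2_sq b k U
    \<le> wL2_sq b 0 G"
proof -
  define C where "C = ennreal ((2 ^ k * pochhammer ((real CARD('n) + 1 + b - 2 * real k) / 4) k)\<^sup>2)"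
  have Cfin: "C < top" by (simp add: C_def)
  have Um[measurable]: "U \<in> borel_measurable lebesgue" using U by (simp add: D_even_def wL2_def)
  have Gm[measurable]: "G \<in> borel_measurable lebesgue" and Gfin: "wL2_sq b 0 G < top"
    using G by (auto simp: is_nabla_D_def wL2_def)
  obtain V where V: "D_approx k b V U"
    and VG: "(\<lambda>m. wL2_sq b 0 (\<lambda>z. nabla_b b k (V m) z - G z)) \<longlonglongrightarrow> 0"
    using G by (auto simp: is_nabla_D_def)
  have VE: "\<And>m. V m \<in> Cinf_c_even" and VU: "(\<lambda>m. wL2_sq b k (\<lambda>z. V m z - U z)) \<longlonglongrightarrow> 0"
    using V by (auto simp: D_approx_def)
  have Vm: "V m \<in> borel_measurable lebesgue" for m
    using VE[of m] by (intro borel_measurable_lebesgueI borel_measurable_continuous_onI)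
      (auto simp: Cinf_c_even_iff Cinf_continuous)
  \<comment> \<open>One factor 1 + d is paid for replacing U by V m, the other for replacing the
    derivative of V m by G.\<close>
  have le: "C * wL2_sq b k U \<le> wL2_sq b 0 G * ennreal ((1 + d)\<^sup>2)" if d: "0 < d" for d
  proof -
    define p q where "p = ennreal (1 + d)" and "q = ennreal (1 + 1 / d)"
    let ?R = "\<lambda>m. p * (p * wL2_sq b 0 G + q * wL2_sq b 0 (\<lambda>z. nabla_b b k (V m) z - G z))
      + C * (q * wL2_sq b k (\<lambda>z. V m z - U z))"
    have "C * wL2_sq b k U \<le> ?R m" for m
    proof -
      have "C * wL2_sq b k U \<le> C * (p * wL2_sq b k (V m) + q * wL2_sq b k (\<lambda>z. V m z - U z))"
        using wL2_sq_add_le[OF Um Vm d, of b k m]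
        unfolding p_def q_def wL2_sq_minus_commute[of b k U] by (intro mult_left_mono) auto
      also have "\<dots> = p * (C * wL2_sq b k (V m)) + C * (q * wL2_sq b k (\<lambda>z. V m z - U z))"
        by (simp add: distrib_left mult.left_commute)
      also have "\<dots> \<le> p * wL2_sq b 0 (nabla_b b k (V m)) + C * (q * wL2_sq b k (\<lambda>z. V m z - U z))"
        using rellich_nabla[OF b VE N, of m] unfolding C_def by (intro add_right_mono mult_left_mono) auto
      also have "\<dots> \<le> ?R m"
        using wL2_sq_add_le[OF nabla_b_measurable[OF VE] Gm d, of b 0 b k m]
        unfolding p_def q_def by (intro add_right_mono mult_left_mono) auto
      finally show ?thesis .
    qed
    moreover have "?R \<longlonglongrightarrow> p * (p * wL2_sq b 0 G + q * 0) + C * (q * 0)"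
      by (intro tendsto_add ennreal_tendsto_cmult VG VU tendsto_const Cfin) (auto simp: p_def q_def)
    ultimately have "C * wL2_sq b k U \<le> p * (p * wL2_sq b 0 G + q * 0) + C * (q * 0)"
      by (intro LIMSEQ_le_const) auto
    also have "\<dots> = wL2_sq b 0 G * ennreal ((1 + d)\<^sup>2)"
      using d by (simp add: p_def power2_eq_square ennreal_mult mult.commute mult.left_commute)
    finally show ?thesis .
  qed
  \<comment> \<open>Here d = 1/(m + 1) tends to 0; finiteness of the norm of G makes multiplication
    by it continuous in \<open>ennreal\<close>.\<close>
  have "(\<lambda>m. wL2_sq b 0 G * ennreal ((1 + inverse (real (Suc m)))\<^sup>2)) \<longlonglongrightarrow> wL2_sq b 0 G * ennreal ((1 + 0)\<^sup>2)"
    by (intro ennreal_tendsto_cmult Gfin tendsto_intros LIMSEQ_inverse_real_of_nat)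
  then have "C * wL2_sq b k U \<le> wL2_sq b 0 G * ennreal ((1 + 0)\<^sup>2)"
    by (rule LIMSEQ_le_const) (use le in auto)
  then show ?thesis by (simp add: C_def)
qed

theorem theorem1p1:
  fixes s b :: real and k :: nat and U :: "(real ^ 'n) \<times> real \<Rightarrow> real"
  assumes "0 < s" and "s < real CARD('n) / 2" and "s \<notin> \<int>"
    and "k = 1 + nat \<lfloor>s\<rfloor>" and "b = 1 - 2 * (s - of_int \<lfloor>s\<rfloor>)"
    and "U \<in> D_even k b"
  shows "(\<integral>\<^sup>+z. ennreal (\<bar>snd z\<bar> powr b * (norm (nabla_D k b k U z))\<^sup>2) \<partial>lebesgue)
     \<ge> ennreal (2 ^ (2 * k) * (Gamma ((real CARD('n) - 2 * s) / 4 + real k))\<^sup>2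
                            / (Gamma ((real CARD('n) - 2 * s) / 4))\<^sup>2)
       * (\<integral>\<^sup>+z. ennreal (\<bar>snd z\<bar> powr b / norm z ^ (2 * k) * \<bar>U z\<bar>\<^sup>2) \<partial>lebesgue)"
proof -
  let ?a = "(real CARD('n) - 2 * s) / 4"
  have b: "- 1 < b"
  proof -
    have "- 1 < 1 - 2 * x" if "x < 1" for x :: real using that by simp
    moreover have "s - of_int \<lfloor>s\<rfloor> < 1" using real_of_int_floor_add_one_gt[of s] by linarith
    ultimately show ?thesis unfolding assms(5) by blast
  qed
  \<comment> \<open>Since s > 0, the floor is nonnegative and \<open>nat\<close> preserves it. In N
    - 2k the floors cancel, leaving n - 2s.\<close>
  have "real k = 1 + of_int \<lfloor>s\<rfloor>" using assms(1,4) by simp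
  then have eq: "real CARD('n) + 1 + b - 2 * real k = real CARD('n) - 2 * s"
    using assms(5) by simp
  have a: "0 < ?a" using assms(2) by simp
  have "is_nabla_D k b k U (nabla_D k b k U)"
    unfolding nabla_D_def using ex_is_nabla_D[OF b assms(6)] by (rule someI_ex)
  from rellich_is_nabla_D[OF b assms(6) this]
  have "ennreal ((2 ^ k * pochhammer ?a k)\<^sup>2) * wL2_sq b k U \<le> wL2_sq b 0 (nabla_D k b k U)"
    unfolding eq using a by simp
  \<comment> \<open>The rising product is a quotient of Gamma values because \<open>?a\<close> is
    positive and so avoids the poles.\<close>
  moreover have "(2 ^ k * pochhammer ?a k)\<^sup>2
      = 2 ^ (2 * k) * (Gamma (?a + real k))\<^sup>2 / (Gamma ?a)\<^sup>2"
    using a by (simp add: pochhammer_Gamma nonpos_Ints_def power_mult_distrib power_divide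
        power_mult[symmetric] mult.commute[of k])
  ultimately show ?thesis by (simp add: wL2_sq_def wt_def)
qed

end
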